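(* Let $q$ be a prime power, let $n$ be an odd integer, and let $k,l$ be integers with $k,l\le \left(1-\frac{\sqrt{2}}{2}\right)q$. Then \[ \mathrm{La}^{*}_{q}(n,\{\mathrm{V}_{k},\Lambda_{l}\}) = \begin{bmatrix} n\\ \frac{n-1}{2}\end{bmatrix}_q, \] and any maximum-size family of subspaces of an $n$-dimensional vector space $V$ over $\mathbb{F}_q$ containing neither $\mathrm{V}_k$ nor $\Lambda_l$ as an induced subposet is either the set of all $\frac{n-1}{2}$-dimensional subspaces of $V$ or the set of all $\frac{n+1}{2}$-dimensional subspaces of $V$.
   Context: Subspaces are ordered by inclusion. A poset $P$ is an induced subposet of $Q$ if there is an injection $\phi:P\to Q$ with $x\le_P y\iff\phi(x)\le_Q\phi(y)$. $\mathrm{V}_k$ is the poset with elements $x_1,\dots,x_k,y$ where $x_1,\dots,x_k>y$ (no other relations), and $\Lambda_k$ is the same poset with all relations reversed. $\mathrm{La}^*_q(n,\mathcal{P})$ is the maximum size of a family of subspaces of an $n$-dimensional vector space over $\mathbb{F}_q$ containing no member of $\mathcal{P}$ as an induced subposet. $\begin{bmatrix} n\\ k\end{bmatrix}_q=\prod_{0\le i<k}\frac{q^{n-i}-1}{q^{k-i}-1}$.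
   Formalization: The integers k, l are assumed to be at least 1, and for n = 1 it is also assumed that k = 1 or l = 1, since for n = 1 and k, l ≥ 2 the family {0, V} has two members and the stated value 1 is wrong. *)

theory Defs
  imports Complex_Main "HOL-Library.Cardinality"
begin

section \<open>Posets and induced subposets\<close>

text \<open>A poset is represented by its reflexive order relation \<open>r\<close>; its ground set is \<open>Field r\<close>.\<close>

definition induced_subposet :: "'a rel \<Rightarrow> 'b rel \<Rightarrow> bool" where
  "induced_subposet P Q \<longleftrightarrow>
     (\<exists>\<phi>. inj_on \<phi> (Field P) \<and> \<phi> ` Field P \<subseteq> Field Q \<and>
          (\<forall>x\<in>Field P. \<forall>y\<in>Field P. (x, y) \<in> P \<longleftrightarrow> (\<phi> x, \<phi> y) \<in> Q))"

text \<open>In \<open>V_poset k\<close> the element \<open>0\<close> plays the role of \<open>y\<close> and \<open>i \<in> {1..k}\<close> that of \<open>x\<^sub>i\<close>.\<close>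

definition V_poset :: "nat \<Rightarrow> nat rel" where
  "V_poset k = {(i, i) | i. i \<le> k} \<union> {(0, i) | i. i \<in> {1..k}}"

definition Lambda_poset :: "nat \<Rightarrow> nat rel" where
  "Lambda_poset k = (V_poset k)\<inverse>"

lemma Field_V_poset: "Field (V_poset k) = {..k}"
  by (auto simp: V_poset_def Field_def)

lemma Field_Lambda_poset: "Field (Lambda_poset k) = {..k}"
  by (simp add: Lambda_poset_def Field_V_poset)

lemma Partial_order_V_poset: "Partial_order (V_poset k)"
  unfolding partial_order_on_def preorder_on_def Field_V_poset
  by (auto simp: V_poset_def refl_on_def trans_def antisym_def)


section \<open>Families of subspaces\<close>

text \<open>
  The ambient space is the whole type \<open>'v\<close> with scalar multiplication \<open>scale\<close>.
  \<open>La_star\<close> is used only when \<open>'v\<close> is finite, so that \<open>Max\<close> ranges over a finite set;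
  that set is nonempty as long as no member of \<open>\<P>\<close> is the empty poset.
\<close>

definition free_subspace_families ::
  "('a::field \<Rightarrow> 'v::ab_group_add \<Rightarrow> 'v) \<Rightarrow> 'p rel set \<Rightarrow> 'v set set set" where
  "free_subspace_families scale \<P> =
     {F. (\<forall>U\<in>F. module.subspace scale U) \<and>
         (\<forall>P\<in>\<P>. \<not> induced_subposet P (relation_of (\<subseteq>) F))}"

definition La_star ::
  "('a::field \<Rightarrow> 'v::ab_group_add \<Rightarrow> 'v) \<Rightarrow> 'p rel set \<Rightarrow> nat" where
  "La_star scale \<P> = Max (card ` free_subspace_families scale \<P>)"

definition subspaces_of_dim ::
  "('a::field \<Rightarrow> 'v::ab_group_add \<Rightarrow> 'v) \<Rightarrow> nat \<Rightarrow> 'v set set" where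
  "subspaces_of_dim scale d =
     {U. module.subspace scale U \<and> vector_space.dim scale U = d}"


section \<open>Gaussian binomial coefficients\<close>

text \<open>The exponents use truncated subtraction, so this is meant for \<open>k \<le> n\<close> and \<open>q > 1\<close>.\<close>

definition gaussian_binomial :: "nat \<Rightarrow> nat \<Rightarrow> nat \<Rightarrow> real" where
  "gaussian_binomial q n k =
     (\<Prod>i<k. (real q ^ (n - i) - 1) / (real q ^ (k - i) - 1))"

end

theory Submission
  imports Defs
begin

text \<open>
  Write \<open>n = 2m + 1\<close> and let \<open>N\<close> be the number of \<open>m\<close>-dimensional subspaces. Fix subspaces \<open>U \<subseteq> W\<close> of
  dimensions \<open>m - 1\<close> and \<open>m + 2\<close>; the subspaces strictly between them are the points and lines of a
  projective plane of order \<open>q\<close>. Add to this plane one subspace of every other dimension, inside \<open>U\<close>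
  or containing \<open>W\<close>. Averaging over all linear automorphisms bounds \<open>|F|\<close> by the largest suitably
  weighted intersection of \<open>F\<close> with an image of this configuration. If an image of one of the outer
  subspaces belongs to \<open>F\<close>, the forbidden posets leave fewer than \<open>3q/10\<close> points and as many lines,
  and the outer dimensions have too little weight to compensate. Otherwise a second moment estimate
  in the plane shows that points and lines in \<open>F\<close> together number less than \<open>q\<^sup>2 + q + 1\<close> unless
  one of the two kinds is missing: through a point of \<open>F\<close> pass at least \<open>t = q + 2 - k\<close> lines outside
  \<open>F\<close>, and \<open>k \<le> (1 - \<surd>2/2) q\<close> makes \<open>t\<^sup>2 - t + 1\<close> exceed half the size of the plane. In the extremal case every
  such plane has either all its points or all its lines in \<open>F\<close>, and neighbouring planes must agree.
\<close>

section \<open>Points and lines of a projective plane\<close>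

text \<open>A second moment bound. Expanding the nonnegative sum of \<open>(r l - t)\<^sup>2\<close>
  over \<open>B\<close> involves the sum of \<open>r l\<close>, which counts incidences, and the sum
  of \<open>(r l)\<^sup>2\<close>, which counts pairs of points on a common line.\<close>

lemma missed_lines_ge:
  fixes inc :: "'p \<Rightarrow> 'l \<Rightarrow> bool" and t :: real
  assumes fin: "finite A" "finite B" and A: "A \<noteq> {}"
    and deg: "\<And>p. p \<in> A \<Longrightarrow> t \<le> real (card {l\<in>B. inc p l})"
    and unique: "\<And>p p'. p \<in> A \<Longrightarrow> p' \<in> A \<Longrightarrow> p \<noteq> p' \<Longrightarrow> card {l\<in>B. inc p l \<and> inc p' l} \<le> 1"
    and t: "t \<ge> 1"
    and le: "card B \<le> card A"
  shows "t\<^sup>2 - t + 1 \<le> real (card A)"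
proof -
  define a where "a = real (card A)"
  define d where "d p = real (card {l\<in>B. inc p l})" for p
  define r where "r l = real (card {p\<in>A. inc p l})" for l
  have a: "a > 0" using A fin by (simp add: a_def card_gt_0_iff)
  have d_eq: "d p = (\<Sum>l\<in>B. if inc p l then 1 else 0)" for p
    using fin by (simp add: d_def sum.If_cases Int_def)
  have r_eq: "r l = (\<Sum>p\<in>A. if inc p l then 1 else 0)" for l
    using fin by (simp add: r_def sum.If_cases Int_def)
  have S1: "(\<Sum>l\<in>B. r l) = (\<Sum>p\<in>A. d p)"
    unfolding r_eq d_eq by (rule sum.swap)
  have "(\<Sum>l\<in>B. (r l)\<^sup>2) = (\<Sum>l\<in>B. \<Sum>p\<in>A. \<Sum>p'\<in>A. if inc p l \<and> inc p' l then 1 else 0)"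
    unfolding r_eq power2_eq_square sum_product by (intro sum.cong refl) auto
  also have "\<dots> = (\<Sum>p\<in>A. \<Sum>p'\<in>A. \<Sum>l\<in>B. if inc p l \<and> inc p' l then 1 else 0)"
    by (subst sum.swap, rule sum.cong[OF refl], rule sum.swap)
  also have "\<dots> = (\<Sum>p\<in>A. \<Sum>p'\<in>A. real (card {l\<in>B. inc p l \<and> inc p' l}))"
    using fin by (simp add: sum.If_cases Int_def)
  \<comment> \<open>The diagonal term is the degree \<open>d p\<close>; two distinct points have at
    most one common line in \<open>B\<close>.\<close>
  also have "\<dots> \<le> (\<Sum>p\<in>A. \<Sum>p'\<in>A. if p' = p then d p else 1)"
    using unique by (intro sum_mono) (auto simp: d_def)
  also have "\<dots> = (\<Sum>p\<in>A. d p + (a - 1))"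
  proof (rule sum.cong[OF refl])
    fix p assume p: "p \<in> A"
    have "(\<Sum>p'\<in>A. if p' = p then d p else 1) = (\<Sum>p'\<in>A. (if p' = p then d p - 1 else 0) + 1)"
      by (intro sum.cong) auto
    also have "\<dots> = d p + (a - 1)"
      unfolding sum.distrib using fin p by (simp add: a_def)
    finally show "(\<Sum>p'\<in>A. if p' = p then d p else 1) = d p + (a - 1)" .
  qed
  also have "\<dots> = (\<Sum>p\<in>A. d p) + a * (a - 1)"
    by (simp add: sum.distrib a_def)
  finally have S2: "(\<Sum>l\<in>B. (r l)\<^sup>2) \<le> (\<Sum>p\<in>A. d p) + a * (a - 1)" .
  \<comment> \<open>A line of \<open>B\<close> meeting \<open>A\<close> in exactly \<open>t\<close> points is the equality case, hence the shift by \<open>t\<close>.\<close>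
  have "0 \<le> (\<Sum>l\<in>B. (r l - t)\<^sup>2)"
    by (intro sum_nonneg) auto
  also have "\<dots> = (\<Sum>l\<in>B. (r l)\<^sup>2) - 2 * t * (\<Sum>l\<in>B. r l) + t\<^sup>2 * card B"
  proof -
    have "(\<Sum>l\<in>B. (r l - t)\<^sup>2) = (\<Sum>l\<in>B. (r l)\<^sup>2 - 2 * t * r l + t\<^sup>2)"
      by (simp add: power2_diff algebra_simps)
    thus ?thesis by (simp add: sum.distrib sum_subtractf mult.commute flip: sum_distrib_left sum_distrib_right)
  qed
  also have "\<dots> \<le> a * (a - 1) - (2 * t - 1) * (\<Sum>p\<in>A. d p) + t\<^sup>2 * a"
  proof -
    have "t\<^sup>2 * card B \<le> t\<^sup>2 * a"
      using le by (intro mult_left_mono) (auto simp: a_def)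
    thus ?thesis using S2 unfolding S1 by (simp add: algebra_simps)
  qed
  also have "\<dots> \<le> a * (a - 1) - (2 * t - 1) * (\<Sum>p\<in>A. t) + t\<^sup>2 * a"
    using t deg by (intro add_mono diff_mono mult_left_mono sum_mono) (use a in \<open>auto simp: d_def\<close>)
  also have "\<dots> = a * (a - (t\<^sup>2 - t + 1))"
    by (simp add: a_def algebra_simps power2_eq_square)
  finally show ?thesis using a by (simp add: zero_le_mult_iff a_def)
qed

text \<open>Here \<open>A\<close> and \<open>B\<close> are the chosen points and lines, so
  \<open>L - B\<close> consists of the missed lines. Few chosen lines through each chosen point mean
  many missed ones, and \<open>missed_lines_ge\<close> makes their total large.\<close>

lemma missed_lines_gt_half:
  fixes inc :: "'p \<Rightarrow> 'l \<Rightarrow> bool" and q k :: nat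
  assumes fin: "finite L" "finite A" and A: "A \<noteq> {}" and B: "B \<subseteq> L"
    and deg: "\<And>p. p \<in> A \<Longrightarrow> card {l\<in>L. inc p l} = q + 1"
    and unique: "\<And>p p'. p \<in> A \<Longrightarrow> p' \<in> A \<Longrightarrow> p \<noteq> p' \<Longrightarrow> card {l\<in>L. inc p l \<and> inc p' l} \<le> 1"
    and less: "\<And>p. p \<in> A \<Longrightarrow> card {l\<in>B. inc p l} < k"
    and k: "real k \<le> (1 - sqrt 2 / 2) * real q"
    and le: "card (L - B) \<le> card A"
  shows "2 * card (L - B) > q\<^sup>2 + q + 1"
proof -
  \<comment> \<open>Of the \<open>q + 1\<close> lines through a point of \<open>A\<close> at most
    \<open>k - 1\<close> lie in \<open>B\<close>, so at least \<open>q + 2 - k\<close> are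
    missed.\<close>
  define t where "t = real q + 2 - real k"
  have t_ge: "t \<ge> sqrt 2 / 2 * real q + 2"
    using k by (simp add: t_def algebra_simps)
  have miss: "t \<le> real (card {l\<in>L - B. inc p l})" if "p \<in> A" for p
  proof -
    have "card {l\<in>L. inc p l} = card ({l\<in>L - B. inc p l} \<union> {l\<in>B. inc p l})"
      using B by (intro arg_cong[where f = card]) auto
    also have "\<dots> = card {l\<in>L - B. inc p l} + card {l\<in>B. inc p l}"
      using fin B by (intro card_Un_disjoint) (auto intro: finite_subset)
    finally show ?thesis using deg[OF that] less[OF that] by (simp add: t_def)
  qed
  \<comment> \<open>The set \<open>A'\<close> chosen below has the size of \<open>L - B\<close> and
    must be nonempty, so \<open>L - B\<close> has to be nonempty.\<close>
  obtain p where p: "p \<in> A" using A by blast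
  have "0 < sqrt 2 / 2 * real q + 2" by (simp add: add_nonneg_pos)
  hence "0 < real (card {l\<in>L - B. inc p l})" using miss[OF p] t_ge by linarith
  hence "card {l\<in>L - B. inc p l} \<noteq> 0" by linarith
  hence "{l\<in>L - B. inc p l} \<noteq> {}" by (metis card.empty)
  hence pos: "L - B \<noteq> {}" by blast
  \<comment> \<open>The hypotheses pass to subsets of \<open>A\<close>, so \<open>A\<close> may be shrunk until it is as small as \<open>L - B\<close>.\<close>
  obtain A' where A': "A' \<subseteq> A" "card A' = card (L - B)"
    using le by (meson obtain_subset_with_card_n)
  have "t\<^sup>2 - t + 1 \<le> real (card A')"
  proof (rule missed_lines_ge[where B = "L - B" and inc = inc])
    show "finite A'" using A' fin finite_subset by blast
    show "A' \<noteq> {}" using A' pos fin by (metis card.empty card_eq_0_iff finite_Diff)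
    show "t \<ge> 1" using t_ge by (smt (verit) mult_nonneg_nonneg of_nat_0_le_iff real_sqrt_ge_zero divide_nonneg_nonneg)
    fix p p' assume pp: "p \<in> A'" "p' \<in> A'" "p \<noteq> p'"
    have "card {l\<in>L - B. inc p l \<and> inc p' l} \<le> card {l\<in>L. inc p l \<and> inc p' l}"
      using fin by (intro card_mono) auto
    also have "\<dots> \<le> 1" using pp A' by (intro unique) auto
    finally show "card {l\<in>L - B. inc p l \<and> inc p' l} \<le> 1" .
  qed (use A' miss fin in auto)
  moreover have "t\<^sup>2 - t + 1 > (real q ^ 2 + real q + 1) / 2"
  proof -
    \<comment> \<open>The main term \<open>s\<^sup>2\<close> is exactly half of
      \<open>q\<^sup>2\<close>, which is where the constant \<open>1 - sqrt 2 / 2\<close> comes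
      from; the term \<open>3 * s \<ge> 3 * q / 2\<close> covers the remaining half of
      \<open>q + 1\<close>, together with the constants.\<close>
    define s where "s = sqrt 2 / 2 * real q"
    have s: "s\<^sup>2 = (real q)\<^sup>2 / 2" "s \<ge> 0"
      by (simp_all add: s_def power_mult_distrib power_divide)
    have "s \<ge> real q / 2"
    proof -
      have "sqrt 2 \<ge> 1" by simp
      thus ?thesis unfolding s_def using mult_right_mono[of 1 "sqrt 2" "real q"] by simp
    qed
    moreover have "t\<^sup>2 - t = t * (t - 1)" by (simp add: algebra_simps power2_eq_square)
    moreover have "t * (t - 1) \<ge> (s + 2) * (s + 1)"
    proof (rule mult_mono)
      have "t \<ge> s + 2" using t_ge by (simp add: s_def)
      thus "s + 2 \<le> t" "s + 1 \<le> t - 1" "0 \<le> t" using s by auto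
    qed (use s in auto)
    moreover have "(s + 2) * (s + 1) = s\<^sup>2 + 3 * s + 2" by (simp add: algebra_simps power2_eq_square)
    ultimately show ?thesis using s by simp
  qed
  ultimately have "(real q ^ 2 + real q + 1) / 2 < real (card (L - B))"
    using A' by simp
  hence "real (q\<^sup>2 + q + 1) < real (2 * card (L - B))" by simp
  thus ?thesis by (simp only: of_nat_less_iff)
qed

text \<open>If the total were at least \<open>q\<^sup>2 + q + 1\<close>, then
  \<open>card (L - B) \<le> card A\<close> and dually \<open>card (P - A) \<le> card B\<close>. So
  \<open>missed_lines_gt_half\<close> applies to the plane and to its dual: more than half of the
  lines and more than half of the points are missed, a contradiction.\<close>

lemma plane_bound:
  fixes inc :: "'p \<Rightarrow> 'l \<Rightarrow> bool" and q k l :: nat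
  assumes fin: "finite P" "finite L" and AP: "A \<subseteq> P" and BL: "B \<subseteq> L"
    and card: "card P = q\<^sup>2 + q + 1" "card L = q\<^sup>2 + q + 1"
    and deg1: "\<And>x. x \<in> P \<Longrightarrow> card {y\<in>L. inc x y} = q + 1"
    and deg2: "\<And>y. y \<in> L \<Longrightarrow> card {x\<in>P. inc x y} = q + 1"
    and unique: "\<And>x x' y y'. x \<in> P \<Longrightarrow> x' \<in> P \<Longrightarrow> x \<noteq> x' \<Longrightarrow> y \<in> L \<Longrightarrow> y' \<in> L \<Longrightarrow>
      inc x y \<Longrightarrow> inc x' y \<Longrightarrow> inc x y' \<Longrightarrow> inc x' y' \<Longrightarrow> y = y'"
    and less1: "\<And>x. x \<in> A \<Longrightarrow> card {y\<in>B. inc x y} < k"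
    and less2: "\<And>y. y \<in> B \<Longrightarrow> card {x\<in>A. inc x y} < l"
    and k: "real k \<le> (1 - sqrt 2 / 2) * real q" and l: "real l \<le> (1 - sqrt 2 / 2) * real q"
    and AB: "A \<noteq> {}" "B \<noteq> {}"
  shows "card A + card B < q\<^sup>2 + q + 1"
proof (rule ccontr)
  assume "\<not> ?thesis"
  hence ge: "q\<^sup>2 + q + 1 \<le> card A + card B" by simp
  have fin': "finite A" "finite B" using fin AP BL by (auto intro: finite_subset)
  have cards: "card (L - B) = card L - card B" "card (P - A) = card P - card A"
    "card B \<le> card L" "card A \<le> card P"
    using fin fin' AP BL by (auto simp: card_Diff_subset card_mono)
  have "2 * card (L - B) > q\<^sup>2 + q + 1"
  proof (rule missed_lines_gt_half[where A = A and inc = inc and k = k])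
    fix p p' assume "p \<in> A" "p' \<in> A" "p \<noteq> p'"
    thus "card {l\<in>L. inc p l \<and> inc p' l} \<le> 1"
      using unique[of p p'] fin AP by (intro card_le_Suc0_iff_eq[THEN iffD2, simplified One_nat_def[symmetric]]) auto
  qed (use fin fin' AB BL AP deg1 less1 k ge cards card in auto)
  moreover have "2 * card (P - A) > q\<^sup>2 + q + 1"
  proof (rule missed_lines_gt_half[where A = B and inc = "\<lambda>y x. inc x y" and k = l])
    \<comment> \<open>Two distinct points on both \<open>y\<close> and \<open>y'\<close> would force
      \<open>y = y'\<close>, so \<open>unique\<close> serves the dual plane as well.\<close>
    fix y y' assume "y \<in> B" "y' \<in> B" "y \<noteq> y'"
    thus "card {x\<in>P. inc x y \<and> inc x y'} \<le> 1"
      using unique[of _ _ y y'] fin BL by (intro card_le_Suc0_iff_eq[THEN iffD2, simplified One_nat_def[symmetric]]) auto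
  qed (use fin fin' AB BL AP deg2 less2 l ge cards card in auto)
  ultimately show False using ge cards card by linarith
qed

section \<open>The posets \<open>V\<close> and \<open>\<Lambda>\<close>\<close>

text \<open>Any \<open>k\<close> elements of the antichain \<open>S\<close> above \<open>y\<close>
  give the copy. The relation \<open>r\<close> is left general so that the converse of inclusion can
  be inserted for \<Lambda>.\<close>

lemma induced_V_posetI:
  assumes S: "finite S" "k \<le> card S"
    and yy: "(y, y) \<in> r" and yx: "\<And>x. x \<in> S \<Longrightarrow> (y, x) \<in> r" and xy: "\<And>x. x \<in> S \<Longrightarrow> (x, y) \<notin> r"
    and xx: "\<And>x x'. x \<in> S \<Longrightarrow> x' \<in> S \<Longrightarrow> (x, x') \<in> r \<longleftrightarrow> x = x'"
  shows "induced_subposet (V_poset k) r"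
proof -
  obtain S' where S': "S' \<subseteq> S" "card S' = k" "finite S'"
    using obtain_subset_with_card_n[OF S(2)] S(1) by (metis finite_subset)
  then obtain h where h: "bij_betw h {1..k} S'"
    using ex_bij_betw_nat_finite_1[of S'] by blast
  define \<phi> where "\<phi> i = (if i = 0 then y else h i)" for i
  have h_S: "h i \<in> S" if "i \<noteq> 0" "i \<le> k" for i
    using bij_betwE[OF h] S'(1) that by auto
  have h_eq: "h i = h j \<longleftrightarrow> i = j" if "i \<noteq> 0" "i \<le> k" "j \<noteq> 0" "j \<le> k" for i j
    using inj_on_eq_iff[OF bij_betw_imp_inj_on[OF h]] that by simp
  have rel: "(i, j) \<in> V_poset k \<longleftrightarrow> (\<phi> i, \<phi> j) \<in> r" if ij: "i \<le> k" "j \<le> k" for i j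
  proof (cases "i = 0")
    case True
    hence "(i, j) \<in> V_poset k" using ij by (auto simp: V_poset_def)
    moreover have "(\<phi> i, \<phi> j) \<in> r"
      using True yy yx[OF h_S[OF _ ij(2)]] by (simp add: \<phi>_def)
    ultimately show ?thesis by blast
  next
    case i: False
    show ?thesis
    proof (cases "j = 0")
      case True
      thus ?thesis using i xy[OF h_S[OF i ij(1)]] by (simp add: \<phi>_def V_poset_def)
    next
      case False
      have "(\<phi> i, \<phi> j) \<in> r \<longleftrightarrow> i = j"
        using xx[OF h_S[OF i ij(1)] h_S[OF False ij(2)]] h_eq[OF i ij(1) False ij(2)] i False
        by (simp add: \<phi>_def)
      thus ?thesis using i ij by (auto simp: V_poset_def)
    qed
  qed
  have refl: "(\<phi> i, \<phi> i) \<in> r" if "i \<le> k" for i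
    using rel[OF that that] that by (simp add: V_poset_def)
  \<comment> \<open>Equal images are related in both directions, so injectivity follows from the
    antisymmetry of \<open>V_poset k\<close>.\<close>
  have "inj_on \<phi> {..k}"
  proof (rule inj_onI)
    fix i j assume "i \<in> {..k}" "j \<in> {..k}" and eq: "\<phi> i = \<phi> j"
    hence "(i, j) \<in> V_poset k" "(j, i) \<in> V_poset k"
      using rel[of i j] rel[of j i] refl[of i] by simp_all
    thus "i = j" by (auto simp: V_poset_def)
  qed
  moreover have "\<phi> ` {..k} \<subseteq> Field r"
    using refl by (auto intro: FieldI1)
  ultimately show ?thesis
    using rel unfolding induced_subposet_def Field_V_poset by (intro exI[of _ \<phi>]) simp
qed

lemma induced_Lambda_poset_iff:
  "induced_subposet (Lambda_poset l) r \<longleftrightarrow> induced_subposet (V_poset l) (r\<inverse>)"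
  unfolding induced_subposet_def Lambda_poset_def Field_converse converse_iff
  by (intro arg_cong[where f = Ex] ext conj_cong refl) blast

text \<open>Inclusion among subspaces of one dimension is such an identity relation. The bound on
  \<open>k\<close> supplies a strict relation in \<open>V_poset k\<close>, which the antichain
  cannot host.\<close>

lemma not_induced_V_poset_Id_on:
  assumes "k \<ge> 1"
  shows "\<not> induced_subposet (V_poset k) (Id_on A)"
proof
  assume "induced_subposet (V_poset k) (Id_on A)"
  then obtain \<phi> where inj: "inj_on \<phi> {..k}" and
    rel: "\<forall>i\<in>{..k}. \<forall>j\<in>{..k}. (i, j) \<in> V_poset k \<longleftrightarrow> (\<phi> i, \<phi> j) \<in> Id_on A"
    unfolding induced_subposet_def Field_V_poset by metis
  have "(0, 1) \<in> V_poset k" using assms by (simp add: V_poset_def)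
  hence "\<phi> 0 = \<phi> 1" using rel assms by (simp add: Id_on_iff)
  thus False using inj_onD[OF inj, of 0 1] assms by simp
qed

section \<open>Counting subspaces\<close>

text \<open>Passing from \<open>d\<close> to \<open>Suc d\<close> adds the last factor to the
  numerators but the first one to the denominators, whose exponents shift. Hence the two products
  are treated separately.\<close>

lemma gaussian_binomial_Suc:
  assumes "q > 1"
  shows "gaussian_binomial q n (Suc d) * (real q ^ Suc d - 1)
         = gaussian_binomial q n d * (real q ^ (n - d) - 1)"
proof -
  have pos: "real q ^ Suc i - 1 > 0" for i
    using one_less_power[of "real q" "Suc i"] assms by simp
  have nz: "(\<Prod>i<d. real q ^ (d - i) - 1) \<noteq> 0"
  proof -
    have "real q ^ (d - i) - 1 > 0" if "i < d" for i
      using pos[of "d - Suc i"] that by (simp add: Suc_diff_Suc flip: power_Suc)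
    thus ?thesis by (intro less_imp_neq[symmetric] prod_pos) auto
  qed
  have "(\<Prod>i<Suc d. real q ^ (Suc d - i) - 1) = (real q ^ Suc d - 1) * (\<Prod>i<d. real q ^ (d - i) - 1)"
    by (subst prod.lessThan_Suc_shift) simp
  moreover have "(\<Prod>i<Suc d. real q ^ (n - i) - 1) = (\<Prod>i<d. real q ^ (n - i) - 1) * (real q ^ (n - d) - 1)"
    by simp
  ultimately show ?thesis
    using nz pos[of d] unfolding gaussian_binomial_def prod_dividef by (simp only:) (simp add: field_simps)
qed

text \<open>Reads off a count from its positive multiple without dividing in
  \<open>nat\<close>.\<close>

lemma nat_mult_right_cancelI: "a * c = z \<Longrightarrow> z = b * c \<Longrightarrow> c > 0 \<Longrightarrow> a = (b :: nat)"
  by simp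

section \<open>Cardinality and dimension over a finite field\<close>

locale finite_vector_space = finite_dimensional_vector_space scale Basis
  for scale :: "'a::{field,finite} \<Rightarrow> 'v::ab_group_add \<Rightarrow> 'v" (infixr \<open>*s\<close> 75)
    and Basis :: "'v set" +
  fixes q :: nat
  assumes q_eq: "q = CARD('a)"
begin

lemma q_ge_2: "q \<ge> 2"
proof -
  have "card {0, 1 :: 'a} \<le> q"
    unfolding q_eq by (rule card_mono) auto
  thus ?thesis by simp
qed

text \<open>Each vector of \<open>span (insert b B)\<close> is \<open>c *s b + v\<close> for exactly
  one scalar \<open>c\<close> and one \<open>v \<in> span B\<close>, so every further basis vector
  multiplies the size by \<open>q\<close>.\<close>

lemma card_span_independent:
  assumes "finite B" "independent B"
  shows "finite (span B) \<and> card (span B) = q ^ card B"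
  using assms
proof (induction B rule: finite_induct)
  case (insert b B)
  have ind: "independent B" and b: "b \<notin> span B"
    using insert.prems insert.hyps by (auto simp: independent_insert)
  have IH: "finite (span B)" "card (span B) = q ^ card B"
    using insert.IH[OF ind] by auto
  let ?f = "\<lambda>(c, v). c *s b + v"
  have "bij_betw ?f (UNIV \<times> span B) (span (insert b B))"
    unfolding bij_betw_def
  proof
    show "inj_on ?f (UNIV \<times> span B)"
    proof (rule inj_onI, clarsimp)
      fix c v c' v'
      assume v: "v \<in> span B" "v' \<in> span B" and eq: "c *s b + v = c' *s b + v'"
      have *: "(c - c') *s b = v' - v"
        using eq by (simp add: scale_left_diff_distrib algebra_simps)
      have "c = c'"
      proof (rule ccontr)
        assume "c \<noteq> c'"
        hence "b = inverse (c - c') *s (v' - v)"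
          by (simp flip: *)
        hence "b \<in> span B"
          using v by (metis span_diff span_scale)
        thus False using b by contradiction
      qed
      thus "c = c' \<and> v = v'" using eq by simp
    qed
    show "?f ` (UNIV \<times> span B) = span (insert b B)"
    proof (intro equalityI subsetI)
      fix x assume "x \<in> ?f ` (UNIV \<times> span B)"
      then obtain c v where "x = c *s b + v" "v \<in> span B" by auto
      hence "x - c *s b \<in> span B" by simp
      thus "x \<in> span (insert b B)" unfolding span_breakdown_eq by blast
    next
      fix x assume "x \<in> span (insert b B)"
      then obtain c where "x - c *s b \<in> span B"
        by (auto simp: span_breakdown_eq)
      thus "x \<in> ?f ` (UNIV \<times> span B)"
        by (intro image_eqI[where x = "(c, x - c *s b)"]) auto
    qed
  qed
  from bij_betw_finite[OF this] bij_betw_same_card[OF this] show ?case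
    using IH insert.hyps by (simp add: card_cartesian_product q_eq)
qed auto

lemma card_subspace: "subspace S \<Longrightarrow> card S = q ^ dim S"
  by (metis basis_subspace_exists card_span_independent)

lemma finite_space: "finite (UNIV :: 'v set)"
  using card_span_independent[OF finite_Basis independent_Basis] span_Basis by simp

lemma finite_vectors [simp, intro]: "finite (S :: 'v set)"
  using finite_space by (rule finite_subset[rotated]) simp

lemma finite_vector_families [simp, intro]: "finite (F :: 'v set set)"
  using finite_space by (simp add: Finite_Set.finite_set finite_subset[OF subset_UNIV])

lemma dim_less: "subspace S \<Longrightarrow> subspace T \<Longrightarrow> S \<subset> T \<Longrightarrow> dim S < dim T"
  by (metis dim_psubset span_eq_iff)

lemma dim_span_insert: "subspace S \<Longrightarrow> v \<notin> S \<Longrightarrow> dim (span (insert v S)) = Suc (dim S)"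
  by (simp add: dim_insert span_eq_iff[THEN iffD2])

lemma span_insert_subset: "subspace T \<Longrightarrow> v \<in> T \<Longrightarrow> S \<subseteq> T \<Longrightarrow> span (insert v S) \<subseteq> T"
  by (rule span_minimal) auto

lemma subset_span_insert: "S \<subseteq> span (insert v S)"
  by (meson dual_order.trans span_superset subset_insertI)

lemma in_span_insert_self: "v \<in> span (insert v S)"
  by (simp add: span_base)

lemma exists_subspace_between:
  assumes "subspace S" "subspace T" "S \<subseteq> T" "dim S \<le> d" "d \<le> dim T"
  obtains X where "subspace X" "S \<subseteq> X" "X \<subseteq> T" "dim X = d"
proof -
  have "\<exists>X. subspace X \<and> S \<subseteq> X \<and> X \<subseteq> T \<and> dim X = d"
    using assms(4,5)
  proof (induction d rule: dec_induct)
    case base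
    show ?case using assms by (intro exI[of _ S]) auto
  next
    case (step d)
    then obtain X where X: "subspace X" "S \<subseteq> X" "X \<subseteq> T" "dim X = d" by auto
    moreover have "X \<noteq> T" using X(4) step.prems by auto
    ultimately obtain v where "v \<in> T" "v \<notin> X" by blast
    moreover have "S \<subseteq> span (insert v X)"
      using X(2) subset_span_insert by (rule order_trans)
    ultimately show ?case
      using X assms(2) dim_span_insert[of X v] span_insert_subset[of T v X]
      by (intro exI[of _ "span (insert v X)"]) auto
  qed
  thus ?thesis using that by blast
qed

section \<open>Points and lines between two nested subspaces\<close>

lemma card_points_between:
  assumes U: "subspace U" and W: "subspace W" and UW: "U \<subseteq> W"
  shows "card {X. subspace X \<and> U \<subseteq> X \<and> X \<subseteq> W \<and> dim X = Suc (dim U)} * (q ^ Suc (dim U) - q ^ dim U)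
         = q ^ dim W - q ^ dim U"
proof -
  let ?P = "{X. subspace X \<and> U \<subseteq> X \<and> X \<subseteq> W \<and> dim X = Suc (dim U)}"
  have span_eq: "X = span (insert v U)" if "X \<in> ?P" "v \<in> X - U" for X v
  proof -
    have X: "subspace X" "U \<subseteq> X" "dim X = Suc (dim U)" and v: "v \<in> X" "v \<notin> U"
      using that by auto
    have "span (insert v U) \<subseteq> X"
      using X v by (intro span_insert_subset)
    from subspace_dim_equal[OF subspace_span X(1) this] show ?thesis
      using X v U by (simp add: dim_span_insert del: dim_span)
  qed
  \<comment> \<open>The sets \<open>X - U\<close> partition \<open>W - U\<close>: a vector
    \<open>v\<close> of \<open>W - U\<close> lies in exactly one of the \<open>X\<close>, namely
    \<open>span (insert v U)\<close>.\<close>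
  have "W - U = (\<Union>X\<in>?P. X - U)"
  proof (intro equalityI subsetI)
    fix v assume v: "v \<in> W - U"
    hence "span (insert v U) \<in> ?P"
      using U W UW by (simp add: dim_span_insert span_insert_subset subset_span_insert del: dim_span)
    moreover have "v \<in> span (insert v U) - U" using v in_span_insert_self by auto
    ultimately show "v \<in> (\<Union>X\<in>?P. X - U)" by blast
  qed blast
  hence "card (W - U) = card (\<Union>X\<in>?P. X - U)" by simp
  also have "\<dots> = (\<Sum>X\<in>?P. card (X - U))"
  proof (rule card_UN_disjoint)
    show "\<forall>X\<in>?P. \<forall>Y\<in>?P. X \<noteq> Y \<longrightarrow> (X - U) \<inter> (Y - U) = {}"
    proof (intro ballI impI equals0I)
      fix X Y v assume "X \<in> ?P" "Y \<in> ?P" "X \<noteq> Y" "v \<in> (X - U) \<inter> (Y - U)"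
      thus False using span_eq[of X v] span_eq[of Y v] by simp
    qed
  qed auto
  also have "\<dots> = (\<Sum>X\<in>?P. q ^ Suc (dim U) - q ^ dim U)"
  proof (rule sum.cong[OF refl])
    fix X assume "X \<in> ?P"
    thus "card (X - U) = q ^ Suc (dim U) - q ^ dim U"
      by (simp add: card_Diff_subset card_subspace U del: power_Suc)
  qed
  also have "\<dots> = card ?P * (q ^ Suc (dim U) - q ^ dim U)"
    by (simp only: sum_constant of_nat_id)
  also have "card (W - U) = q ^ dim W - q ^ dim U"
    using U W UW by (simp add: card_Diff_subset card_subspace)
  finally show ?thesis by (rule sym)
qed

lemma card_between_rank2:
  assumes "subspace U" "subspace W" "U \<subseteq> W" "dim W = dim U + 2"
  shows "card {X. subspace X \<and> U \<subseteq> X \<and> X \<subseteq> W \<and> dim X = Suc (dim U)} = q + 1"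
proof -
  let ?c = "card {X. subspace X \<and> U \<subseteq> X \<and> X \<subseteq> W \<and> dim X = Suc (dim U)}"
  have "?c * (q ^ Suc (dim U) - q ^ dim U) = q ^ dim W - q ^ dim U"
    by (rule card_points_between[OF assms(1-3)])
  moreover have "q ^ dim W - q ^ dim U = (q + 1) * (q ^ Suc (dim U) - q ^ dim U)"
    using assms(4) by (simp add: algebra_simps power_add power2_eq_square)
  moreover have "q ^ Suc (dim U) - q ^ dim U > 0"
    using q_ge_2 by simp
  ultimately show ?thesis by (rule nat_mult_right_cancelI)
qed

lemma card_points_rank3:
  assumes "subspace U" "subspace W" "U \<subseteq> W" "dim W = dim U + 3"
  shows "card {X. subspace X \<and> U \<subseteq> X \<and> X \<subseteq> W \<and> dim X = Suc (dim U)} = q\<^sup>2 + q + 1"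
proof -
  let ?c = "card {X. subspace X \<and> U \<subseteq> X \<and> X \<subseteq> W \<and> dim X = Suc (dim U)}"
  have "?c * (q ^ Suc (dim U) - q ^ dim U) = q ^ dim W - q ^ dim U"
    by (rule card_points_between[OF assms(1-3)])
  moreover have "q ^ dim W - q ^ dim U = (q\<^sup>2 + q + 1) * (q ^ Suc (dim U) - q ^ dim U)"
    using assms(4) by (simp add: algebra_simps power_add power2_eq_square power3_eq_cube)
  moreover have "q ^ Suc (dim U) - q ^ dim U > 0"
    using q_ge_2 by simp
  ultimately show ?thesis by (rule nat_mult_right_cancelI)
qed

text \<open>Incident pairs are counted in two ways: each point lies on \<open>q + 1\<close> lines
  and each line carries \<open>q + 1\<close> points, so there are as many lines as points.\<close>

lemma card_lines_rank3:
  assumes U: "subspace U" and W: "subspace W" and "U \<subseteq> W" and dims: "dim W = dim U + 3"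
  shows "card {X. subspace X \<and> U \<subseteq> X \<and> X \<subseteq> W \<and> dim X = dim U + 2} = q\<^sup>2 + q + 1"
proof -
  let ?P = "{X. subspace X \<and> U \<subseteq> X \<and> X \<subseteq> W \<and> dim X = Suc (dim U)}"
  let ?L = "{X. subspace X \<and> U \<subseteq> X \<and> X \<subseteq> W \<and> dim X = dim U + 2}"
  have "(\<Sum>p\<in>?P. card {l\<in>?L. p \<subseteq> l}) = (q + 1) * card ?L"
  proof (rule sum_multicount)
    show "\<forall>l\<in>?L. card {p\<in>?P. p \<subseteq> l} = q + 1"
    proof
      fix l assume l: "l \<in> ?L"
      have "{p\<in>?P. p \<subseteq> l} = {X. subspace X \<and> U \<subseteq> X \<and> X \<subseteq> l \<and> dim X = Suc (dim U)}"
        using l by auto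
      thus "card {p\<in>?P. p \<subseteq> l} = q + 1"
        using card_between_rank2[of U l] l U by simp
    qed
  qed auto
  also have "(\<Sum>p\<in>?P. card {l\<in>?L. p \<subseteq> l}) = (\<Sum>p\<in>?P. q + 1)"
  proof (rule sum.cong[OF refl])
    fix p assume p: "p \<in> ?P"
    have "{l\<in>?L. p \<subseteq> l} = {X. subspace X \<and> p \<subseteq> X \<and> X \<subseteq> W \<and> dim X = Suc (dim p)}"
      using p by auto
    thus "card {l\<in>?L. p \<subseteq> l} = q + 1"
      using card_between_rank2[of p W] p W dims by simp
  qed
  finally have "(q + 1) * card ?P = (q + 1) * card ?L" by (simp add: mult.commute)
  hence "card ?P = card ?L" by (subst (asm) mult_left_cancel) auto
  thus ?thesis using card_points_rank3[OF assms] by simp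
qed

text \<open>Both lines are spanned by \<open>p\<close> and one vector of \<open>p'\<close> outside
  \<open>p\<close>.\<close>

lemma line_through_points_unique:
  assumes "subspace p" "subspace p'" "subspace l" "subspace l'" "dim p = d" "dim p' = d" "p \<noteq> p'"
    and "p \<subseteq> l" "p' \<subseteq> l" "p \<subseteq> l'" "p' \<subseteq> l'" "dim l = Suc d" "dim l' = Suc d"
  shows "l = l'"
proof -
  have "\<not> p' \<subseteq> p"
    using assms subspace_dim_equal[of p' p] by auto
  then obtain v where v: "v \<in> p'" "v \<notin> p" by blast
  have "X = span (insert v p)" if "subspace X" "p \<subseteq> X" "p' \<subseteq> X" "dim X = Suc d" for X
    using that v assms dim_span_insert[of p v]
    by (intro subspace_dim_equal[symmetric] span_insert_subset) auto
  thus ?thesis using assms by metis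
qed

section \<open>Ordered bases and the number of subspaces\<close>

lemma card_independent_lists:
  assumes S: "subspace S"
  shows "card {xs. length xs = d \<and> distinct xs \<and> independent (set xs) \<and> set xs \<subseteq> S}
         = (\<Prod>i<d. q ^ dim S - q ^ i)"
    and "finite {xs. length xs = d \<and> distinct xs \<and> independent (set xs) \<and> set xs \<subseteq> S}"
proof -
  let ?L = "\<lambda>d. {xs. length xs = d \<and> distinct xs \<and> independent (set xs) \<and> set xs \<subseteq> S}"
  have fin: "finite (?L d)" for d
    by (rule finite_subset[OF _ finite_lists_length_eq[OF finite_vectors[of S], of d]]) auto
  have "card (?L d) = (\<Prod>i<d. q ^ dim S - q ^ i)"
  proof (induction d)
    case 0
    have "?L 0 = {[]}" by (auto simp: independent_empty)
    thus ?case by simp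
  next
    case (Suc d)
    \<comment> \<open>The vector put in front is any element of \<open>S\<close> outside the span of
      the earlier ones, which has \<open>q ^ d\<close> elements. For lists longer than
      \<open>dim S\<close> the product vanishes through its factor at
      \<open>i = dim S\<close>.\<close>
    have "?L (Suc d) = (\<Union>xs\<in>?L d. (\<lambda>x. x # xs) ` (S - span (set xs)))"
    proof (intro equalityI subsetI)
      fix ys assume ys: "ys \<in> ?L (Suc d)"
      then obtain x xs where "ys = x # xs" by (cases ys) auto
      thus "ys \<in> (\<Union>xs\<in>?L d. (\<lambda>x. x # xs) ` (S - span (set xs)))"
        using ys by (auto simp: independent_insert)
    next
      fix ys assume "ys \<in> (\<Union>xs\<in>?L d. (\<lambda>x. x # xs) ` (S - span (set xs)))"
      then obtain x xs where "ys = x # xs" "xs \<in> ?L d" "x \<in> S" "x \<notin> span (set xs)" by blast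
      thus "ys \<in> ?L (Suc d)"
        using span_superset by (auto simp: independent_insert)
    qed
    hence "card (?L (Suc d)) = card (\<Union>xs\<in>?L d. (\<lambda>x. x # xs) ` (S - span (set xs)))" by simp
    also have "\<dots> = (\<Sum>xs\<in>?L d. card ((\<lambda>x. x # xs) ` (S - span (set xs))))"
      by (rule card_UN_disjoint) (use fin in auto)
    also have "\<dots> = (\<Sum>xs\<in>?L d. q ^ dim S - q ^ d)"
    proof (rule sum.cong[OF refl])
      fix xs assume xs: "xs \<in> ?L d"
      have "span (set xs) \<subseteq> S" using xs S by (intro span_minimal) auto
      moreover have "card (span (set xs)) = q ^ d"
        using xs by (metis (mono_tags, lifting) card_span_independent distinct_card finite_set mem_Collect_eq)
      ultimately show "card ((\<lambda>x. x # xs) ` (S - span (set xs))) = q ^ dim S - q ^ d"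
        by (subst card_image) (auto simp: card_Diff_subset card_subspace S intro: inj_onI)
    qed
    finally show ?case using Suc by simp
  qed
  thus "card (?L d) = (\<Prod>i<d. q ^ dim S - q ^ i)" "finite (?L d)" using fin by auto
qed

text \<open>The independent lists of length \<open>d\<close> are partitioned according to the
  subspace that they span.\<close>

lemma card_subspaces_of_dim_mult:
  "card (subspaces_of_dim scale d) * (\<Prod>i<d. q ^ d - q ^ i) = (\<Prod>i<d. q ^ dimension - q ^ i)"
proof -
  let ?L = "\<lambda>S. {xs. length xs = d \<and> distinct xs \<and> independent (set xs) \<and> set xs \<subseteq> S}"
  have span_eq: "span (set xs) = X" if "X \<in> subspaces_of_dim scale d" "xs \<in> ?L X" for xs X
    using that by (intro subspace_dim_equal)
      (auto simp: subspaces_of_dim_def span_minimal dim_eq_card_independent distinct_card)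
  have "?L UNIV = (\<Union>X\<in>subspaces_of_dim scale d. ?L X)"
  proof (intro equalityI subsetI)
    fix xs assume xs: "xs \<in> ?L UNIV"
    hence "span (set xs) \<in> subspaces_of_dim scale d" "xs \<in> ?L (span (set xs))"
      by (auto simp: subspaces_of_dim_def dim_eq_card_independent distinct_card span_base)
    thus "xs \<in> (\<Union>X\<in>subspaces_of_dim scale d. ?L X)" by blast
  qed auto
  hence "card (?L UNIV) = card (\<Union>X\<in>subspaces_of_dim scale d. ?L X)" by simp
  also have "\<dots> = (\<Sum>X\<in>subspaces_of_dim scale d. card (?L X))"
  proof (rule card_UN_disjoint)
    show "\<forall>X\<in>subspaces_of_dim scale d. finite (?L X)"
      by (auto simp: subspaces_of_dim_def intro!: card_independent_lists(2))
    show "\<forall>X\<in>subspaces_of_dim scale d. \<forall>Y\<in>subspaces_of_dim scale d. X \<noteq> Y \<longrightarrow> ?L X \<inter> ?L Y = {}"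
      using span_eq by blast
  qed auto
  also have "\<dots> = (\<Sum>X\<in>subspaces_of_dim scale d. \<Prod>i<d. q ^ d - q ^ i)"
    by (intro sum.cong refl) (simp add: subspaces_of_dim_def card_independent_lists(1))
  finally show ?thesis
    using card_independent_lists(1)[OF subspace_UNIV, of d] by (simp add: dimension_def)
qed

lemma card_subspaces_of_dim:
  assumes "d \<le> dimension"
  shows "real (card (subspaces_of_dim scale d)) = gaussian_binomial q dimension d"
proof -
  have q: "real q > 1" using q_ge_2 by linarith
  \<comment> \<open>Extracting \<open>q ^ i\<close> from each factor leaves the factors of the
    Gaussian binomial. The extracted powers are the same for \<open>m = d\<close> and
    \<open>m = dimension\<close>, so they cancel.\<close>
  have *: "real (\<Prod>i<d. q ^ m - q ^ i) = (\<Prod>i<d. real q ^ i) * (\<Prod>i<d. real q ^ (m - i) - 1)"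
    if "d \<le> m" for m
  proof -
    have "real (q ^ m - q ^ i) = real q ^ i * (real q ^ (m - i) - 1)" if "i < d" for i
    proof -
      have le: "q ^ i \<le> q ^ m"
        using q_ge_2 that \<open>d \<le> m\<close> by (intro power_increasing) auto
      have "real q ^ m = real q ^ i * real q ^ (m - i)"
        using that \<open>d \<le> m\<close> by (simp flip: power_add)
      thus ?thesis using le by (simp add: algebra_simps)
    qed
    thus ?thesis by (simp flip: prod.distrib)
  qed
  have "real (card (subspaces_of_dim scale d)) * real (\<Prod>i<d. q ^ d - q ^ i)
        = real (\<Prod>i<d. q ^ dimension - q ^ i)"
    unfolding card_subspaces_of_dim_mult[symmetric] by simp
  hence "real (card (subspaces_of_dim scale d)) * (\<Prod>i<d. real q ^ (d - i) - 1)
         = (\<Prod>i<d. real q ^ (dimension - i) - 1)"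
    using q assms by (simp only: *) simp
  moreover have "(\<Prod>i<d. real q ^ (d - i) - 1) \<noteq> 0"
  proof -
    have "real q ^ (d - i) > 1" if "i < d" for i
      using q that by (intro one_less_power) auto
    hence "\<forall>i<d. real q ^ (d - i) \<noteq> 1" by (metis less_irrefl)
    thus ?thesis by (simp add: prod_zero_iff)
  qed
  ultimately show ?thesis
    by (simp add: gaussian_binomial_def prod_dividef nonzero_eq_divide_eq)
qed

section \<open>Growth of the levels towards the middle\<close>

abbreviation level_size :: "nat \<Rightarrow> real" where
  "level_size d \<equiv> real (card (subspaces_of_dim scale d))"

lemma dim_le_dimension: "dim S \<le> dimension"
  by (rule dim_subset_UNIV)

lemma level_size_pos:
  assumes "d \<le> dimension"
  shows "level_size d > 0"
proof -
  obtain X where "subspace X" "dim X = d"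
    using exists_subspace_between[of "{0}" UNIV d] assms
    by (auto simp: subspace_single_0 dimension_def)
  hence "subspaces_of_dim scale d \<noteq> {}" by (auto simp: subspaces_of_dim_def)
  thus ?thesis by (simp add: card_gt_0_iff)
qed

lemma level_size_Suc:
  assumes "d < dimension"
  shows "level_size (Suc d) * (real q ^ Suc d - 1) = level_size d * (real q ^ (dimension - d) - 1)"
  using gaussian_binomial_Suc[of q dimension d] assms q_ge_2
  by (simp add: card_subspaces_of_dim del: power_Suc)

text \<open>Meant for the exponents in \<open>level_size_Suc\<close>: if the dimension is
  \<open>2 * m + 1\<close>, then \<open>Suc i\<close> and \<open>dimension - i\<close> add up to
  \<open>2 * m + 2\<close>, so they differ by at least 2 unless \<open>i = m\<close>.\<close>

lemma power_gap:
  assumes "b + 2 \<le> a" "b > 0"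
  shows "(real q)\<^sup>2 * (real q ^ b - 1) \<le> real q ^ a - 1" "real q ^ b - 1 > 0"
proof -
  have q: "real q > 1" using q_ge_2 by linarith
  have "real q ^ (b + 2) \<le> real q ^ a" using assms q by (intro power_increasing) auto
  moreover have "(real q)\<^sup>2 \<ge> 1" using q by simp
  ultimately show "(real q)\<^sup>2 * (real q ^ b - 1) \<le> real q ^ a - 1"
    by (simp add: algebra_simps power_add power2_eq_square)
  show "real q ^ b - 1 > 0" using one_less_power[OF q assms(2)] by simp
qed

lemma level_size_growth:
  assumes "i < m" and dimension: "dimension = 2 * m + 1"
  shows "(real q)\<^sup>2 * level_size i \<le> level_size (Suc i)"
proof -
  have eq: "level_size (Suc i) * (real q ^ Suc i - 1) = level_size i * (real q ^ (dimension - i) - 1)"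
    using assms by (intro level_size_Suc) simp
  have gap: "(real q)\<^sup>2 * (real q ^ Suc i - 1) \<le> real q ^ (dimension - i) - 1" "real q ^ Suc i - 1 > 0"
    using power_gap[of "Suc i" "dimension - i"] assms by auto
  have "(real q)\<^sup>2 * level_size i * (real q ^ Suc i - 1)
      = level_size i * ((real q)\<^sup>2 * (real q ^ Suc i - 1))" by simp
  also have "\<dots> \<le> level_size (Suc i) * (real q ^ Suc i - 1)"
    unfolding eq using gap by (intro mult_left_mono) auto
  finally show ?thesis by (rule mult_right_le_imp_le) (rule gap)
qed

lemma level_size_decay:
  assumes "m < i" "i < dimension" and dimension: "dimension = 2 * m + 1"
  shows "(real q)\<^sup>2 * level_size (Suc i) \<le> level_size i"
proof -
  have eq: "level_size (Suc i) * (real q ^ Suc i - 1) = level_size i * (real q ^ (dimension - i) - 1)"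
    using assms by (intro level_size_Suc) simp
  have gap: "(real q)\<^sup>2 * (real q ^ (dimension - i) - 1) \<le> real q ^ Suc i - 1" "real q ^ (dimension - i) - 1 > 0"
    using power_gap[of "dimension - i" "Suc i"] assms by auto
  have "(real q)\<^sup>2 * level_size (Suc i) * (real q ^ (dimension - i) - 1)
      = level_size (Suc i) * ((real q)\<^sup>2 * (real q ^ (dimension - i) - 1))" by simp
  also have "\<dots> \<le> level_size i * (real q ^ (dimension - i) - 1)"
    unfolding eq[symmetric] using gap by (intro mult_left_mono) auto
  finally show ?thesis by (rule mult_right_le_imp_le) (rule gap)
qed

text \<open>At \<open>d = m\<close> the two exponents in \<open>level_size_Suc\<close>
  coincide.\<close>

lemma level_size_middle:
  assumes "dimension = 2 * m + 1"
  shows "level_size (Suc m) = level_size m"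
proof -
  have "real q ^ Suc m - 1 > 0"
    using q_ge_2 one_less_power[of "real q" "Suc m"] by simp
  moreover have "level_size (Suc m) * (real q ^ Suc m - 1) = level_size m * (real q ^ (dimension - m) - 1)"
    using assms by (intro level_size_Suc) simp
  moreover have "dimension - m = Suc m" using assms by simp
  ultimately show ?thesis by (simp only: mult_cancel_right) linarith
qed

text \<open>Each level has at least \<open>q\<^sup>2\<close> times the size of the previous one, so
  the lower levels are dominated by a geometric series with sum
  \<open>1 / (q\<^sup>2 - 1)\<close>.\<close>

lemma sum_level_size_below:
  assumes "j \<le> m" and dimension: "dimension = 2 * m + 1"
  shows "((real q)\<^sup>2 - 1) * (\<Sum>i<j. level_size i) \<le> level_size j"
  using assms(1)
proof (induction j)
  case (Suc j)
  hence IH: "((real q)\<^sup>2 - 1) * (\<Sum>i<j. level_size i) \<le> level_size j" by simp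
  have "(real q)\<^sup>2 * level_size j \<le> level_size (Suc j)"
    using Suc.prems dimension by (intro level_size_growth) auto
  thus ?case using IH by (simp add: algebra_simps)
qed simp

text \<open>The mirror image above the middle; the induction descends from the top dimension, where
  the sum is empty.\<close>

lemma sum_level_size_above:
  assumes "m < j" "j \<le> dimension" and dimension: "dimension = 2 * m + 1"
  shows "((real q)\<^sup>2 - 1) * (\<Sum>i\<in>{j<..dimension}. level_size i) \<le> level_size j"
  using assms(2,1)
proof (induction j rule: inc_induct)
  case (step j)
  hence IH: "((real q)\<^sup>2 - 1) * (\<Sum>i\<in>{Suc j<..dimension}. level_size i) \<le> level_size (Suc j)" by simp
  have "{j<..dimension} = insert (Suc j) {Suc j<..dimension}" using step.hyps by auto
  hence "(\<Sum>i\<in>{j<..dimension}. level_size i) = level_size (Suc j) + (\<Sum>i\<in>{Suc j<..dimension}. level_size i)"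
    by simp
  moreover have "(real q)\<^sup>2 * level_size (Suc j) \<le> level_size j"
    using step dimension by (intro level_size_decay) auto
  ultimately show ?case using IH by (simp add: algebra_simps)
qed simp

section \<open>Averaging over automorphisms\<close>

definition automorphisms :: "('v \<Rightarrow> 'v) set" where
  "automorphisms = {g. Vector_Spaces.linear scale scale g \<and> bij g}"

lemma finite_automorphisms: "finite automorphisms"
  by (rule finite_subset[OF subset_UNIV]) (simp add: finite_UNIV_fun)

lemma id_in_automorphisms: "id \<in> automorphisms"
  by (simp add: automorphisms_def linear_id bij_id)

lemma comp_in_automorphisms: "f \<in> automorphisms \<Longrightarrow> g \<in> automorphisms \<Longrightarrow> f \<circ> g \<in> automorphisms"
  by (simp add: automorphisms_def Vector_Spaces.linear_compose[of scale scale g scale f] bij_comp)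

lemma inj_automorphism: "g \<in> automorphisms \<Longrightarrow> inj g"
  by (simp add: automorphisms_def bij_def)

lemma automorphism_image_subset_iff: "g \<in> automorphisms \<Longrightarrow> g ` S \<subseteq> g ` T \<longleftrightarrow> S \<subseteq> T"
  by (simp add: inj_automorphism inj_image_subset_iff)

lemma automorphism_image_eq_iff: "g \<in> automorphisms \<Longrightarrow> g ` S = g ` T \<longleftrightarrow> S = T"
  by (simp add: inj_automorphism inj_image_eq_iff)

lemma subspace_automorphism_image:
  assumes "g \<in> automorphisms" "subspace S"
  shows "subspace (g ` S)"
proof -
  interpret g: Vector_Spaces.linear scale scale g
    using assms by (simp add: automorphisms_def)
  show ?thesis using assms by (intro g.subspace_image)
qed

lemma dim_automorphism_image:
  assumes "g \<in> automorphisms" "subspace S"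
  shows "dim (g ` S) = dim S"
proof -
  have "card (g ` S) = card S"
    by (rule card_image) (rule inj_on_subset[OF inj_automorphism[OF assms(1)] subset_UNIV])
  hence "q ^ dim (g ` S) = q ^ dim S"
    using assms by (simp add: card_subspace subspace_automorphism_image)
  thus ?thesis using q_ge_2 by simp
qed

text \<open>Bases of \<open>S\<close> and \<open>T\<close> extend to bases of the whole space.
  Matching basis with basis and remainder with remainder defines a linear surjection, which is
  bijective in finite dimension.\<close>

lemma exists_automorphism:
  assumes S: "subspace S" and T: "subspace T" and dim_eq: "dim S = dim T"
  obtains g where "g \<in> automorphisms" "g ` S = T"
proof -
  obtain B where B: "finite B" "independent B" "span B = S" "card B = dim S"
    using S by (metis basis_subspace_exists)
  obtain C where C: "finite C" "independent C" "span C = T" "card C = dim T"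
    using T by (metis basis_subspace_exists)
  obtain B' where "B \<subseteq> B'" "independent B'" "UNIV \<subseteq> span B'"
    using maximal_independent_subset_extend[OF subset_UNIV B(2)] by metis
  hence B': "B \<subseteq> B'" "independent B'" "span B' = UNIV" by auto
  obtain C' where "C \<subseteq> C'" "independent C'" "UNIV \<subseteq> span C'"
    using maximal_independent_subset_extend[OF subset_UNIV C(2)] by metis
  hence C': "C \<subseteq> C'" "independent C'" "span C' = UNIV" by auto
  have fin: "finite B'" "finite C'" using B' C' by (auto intro: finiteI_independent)
  have "card B' = card C'"
    using dim_span_eq_card_independent[OF B'(2)] dim_span_eq_card_independent[OF C'(2)]
    by (simp only: B'(3) C'(3))
  hence card_eq: "card (B' - B) = card (C' - C)"
    by (simp only: card_Diff_subset[OF B(1) B'(1)] card_Diff_subset[OF C(1) C'(1)] B(4) C(4) dim_eq)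
  obtain h1 where h1: "bij_betw h1 B C"
    using finite_same_card_bij[OF B(1) C(1)] unfolding B(4) C(4) dim_eq by blast
  obtain h2 where h2: "bij_betw h2 (B' - B) (C' - C)"
    using finite_same_card_bij[OF finite_Diff[OF fin(1)] finite_Diff[OF fin(2)] card_eq] by blast
  interpret finite_dimensional_vector_space_pair scale Basis scale Basis
    by unfold_locales
  obtain g where g: "Vector_Spaces.linear scale scale g"
    "\<forall>x\<in>B'. g x = (if x \<in> B then h1 x else h2 x)"
    using linear_independent_extend[OF B'(2), of "\<lambda>x. if x \<in> B then h1 x else h2 x"] by blast
  interpret g: Vector_Spaces.linear scale scale g by fact
  have gB: "g ` B = C"
    using g(2) B'(1) bij_betw_imp_surj_on[OF h1] by (simp add: subset_iff cong: image_cong)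
  moreover have "g ` (B' - B) = C' - C"
  proof -
    have "g ` (B' - B) = h2 ` (B' - B)"
      by (rule image_cong[OF refl]) (use g(2) in simp)
    thus ?thesis by (simp only: bij_betw_imp_surj_on[OF h2])
  qed
  moreover have "g ` B' = g ` B \<union> g ` (B' - B)"
    using B'(1) by (simp flip: image_Un add: Un_absorb1)
  ultimately have gB': "g ` B' = C'"
    using C'(1) by (simp add: Un_absorb1)
  have "g ` UNIV = UNIV"
    using g.span_image[of B'] by (simp only: B'(3) C'(3) gB')
  hence "bij g"
    using g(1) linear_surj_imp_inj[OF g(1)] by (simp add: bij_def)
  moreover have "g ` S = T"
    using g.span_image[of B] by (simp only: B(3) C(3) gB)
  ultimately show ?thesis
    using g(1) by (intro that[of g]) (simp_all add: automorphisms_def)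
qed

lemma finite_automorphisms_Collect [simp]: "finite {g\<in>automorphisms. P g}"
  using finite_automorphisms by simp

text \<open>Composing with an automorphism that carries \<open>T\<close> to \<open>T'\<close> embeds
  the first set into the second, and the roles can be exchanged.\<close>

lemma card_automorphisms_onto_eq:
  assumes "subspace S" "subspace T" "subspace T'" "dim T = dim T'"
  shows "card {g\<in>automorphisms. g ` S = T} = card {g\<in>automorphisms. g ` S = T'}"
proof -
  have le: "card {g\<in>automorphisms. g ` S = X} \<le> card {g\<in>automorphisms. g ` S = Y}"
    if XY: "subspace X" "subspace Y" "dim X = dim Y" for X Y
  proof -
    obtain t where t: "t \<in> automorphisms" "t ` X = Y"
      using exists_automorphism[OF XY] by blast
    have "inj_on ((\<circ>) t) {g\<in>automorphisms. g ` S = X}"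
      using inj_automorphism[OF t(1)] by (intro inj_onI) (simp add: fun.inj_map_strong inj_eq fun_eq_iff)
    moreover have "(\<circ>) t ` {g\<in>automorphisms. g ` S = X} \<subseteq> {g\<in>automorphisms. g ` S = Y}"
    proof (rule image_subsetI)
      fix g assume g: "g \<in> {g\<in>automorphisms. g ` S = X}"
      hence "(t \<circ> g) ` S = Y" using t image_comp[of t g S] by (simp del: o_apply)
      thus "t \<circ> g \<in> {g\<in>automorphisms. g ` S = Y}"
        using g t comp_in_automorphisms by simp
    qed
    ultimately show ?thesis by (rule card_inj_on_le) simp
  qed
  show ?thesis
    using le[OF assms(2,3,4)] le[OF assms(3,2) assms(4)[symmetric]] by (rule antisym)
qed

text \<open>The automorphism group acts transitively on the subspaces of each dimension, so a random
  automorphism moves \<open>S\<close> to a uniformly distributed subspace of its dimension.\<close>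

lemma card_automorphisms_into:
  assumes S: "subspace S" and F: "\<And>X. X \<in> F \<Longrightarrow> subspace X"
  shows "card {g\<in>automorphisms. g ` S \<in> F} * card (subspaces_of_dim scale (dim S))
         = card automorphisms * card {X\<in>F. dim X = dim S}"
proof -
  \<comment> \<open>Used for \<open>F\<close> and for the family of all subspaces. The second use is
    the orbit-stabiliser formula; combining both eliminates the stabiliser of
    \<open>S\<close>.\<close>
  have split: "card {g\<in>automorphisms. g ` S \<in> E} =
      card {X\<in>E. dim X = dim S} * card {g\<in>automorphisms. g ` S = S}"
    if E: "\<And>X. X \<in> E \<Longrightarrow> subspace X" for E
  proof -
    have "{g\<in>automorphisms. g ` S \<in> E} = (\<Union>X\<in>{X\<in>E. dim X = dim S}. {g\<in>automorphisms. g ` S = X})"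
      using S dim_automorphism_image by auto
    hence "card {g\<in>automorphisms. g ` S \<in> E}
        = card (\<Union>X\<in>{X\<in>E. dim X = dim S}. {g\<in>automorphisms. g ` S = X})" by simp
    also have "\<dots> = (\<Sum>X\<in>{X\<in>E. dim X = dim S}. card {g\<in>automorphisms. g ` S = X})"
      by (rule card_UN_disjoint) auto
    also have "\<dots> = (\<Sum>X\<in>{X\<in>E. dim X = dim S}. card {g\<in>automorphisms. g ` S = S})"
    proof (rule sum.cong[OF refl])
      fix X assume "X \<in> {X\<in>E. dim X = dim S}"
      thus "card {g\<in>automorphisms. g ` S = X} = card {g\<in>automorphisms. g ` S = S}"
        using E[of X] S by (intro card_automorphisms_onto_eq) simp_all
    qed
    finally show ?thesis by (simp only: sum_constant of_nat_id)
  qed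
  have "{X \<in> {X. subspace X}. dim X = dim S} = subspaces_of_dim scale (dim S)"
    by (auto simp: subspaces_of_dim_def)
  moreover have "{g\<in>automorphisms. g ` S \<in> {X. subspace X}} = automorphisms"
    using S subspace_automorphism_image by auto
  moreover have "card {g\<in>automorphisms. g ` S \<in> {X. subspace X}} =
      card {X \<in> {X. subspace X}. dim X = dim S} * card {g\<in>automorphisms. g ` S = S}"
    by (rule split) simp
  ultimately have "card automorphisms
      = card (subspaces_of_dim scale (dim S)) * card {g\<in>automorphisms. g ` S = S}"
    by (simp only:)
  moreover have "card {g\<in>automorphisms. g ` S \<in> F} =
      card {X\<in>F. dim X = dim S} * card {g\<in>automorphisms. g ` S = S}"
    using F by (rule split)
  ultimately show ?thesis by (simp only: mult_ac)
qed

text \<open>Double counting of the pairs of an automorphism and a member of \<open>\<S>\<close> that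
  it carries into \<open>F\<close>.\<close>

lemma sum_card_automorphisms_into:
  assumes S: "\<And>X. X \<in> \<S> \<Longrightarrow> subspace X \<and> dim X = d" and F: "\<And>X. X \<in> F \<Longrightarrow> subspace X"
  shows "(\<Sum>g\<in>automorphisms. card {X\<in>\<S>. g ` X \<in> F}) * card (subspaces_of_dim scale d)
         = card \<S> * card automorphisms * card {X\<in>F. dim X = d}"
proof -
  have "(\<Sum>g\<in>automorphisms. card {X\<in>\<S>. g ` X \<in> F}) = (\<Sum>X\<in>\<S>. card {g\<in>automorphisms. g ` X \<in> F})"
    by (rule sum_multicount_gen) (auto simp: finite_automorphisms)
  hence "(\<Sum>g\<in>automorphisms. card {X\<in>\<S>. g ` X \<in> F}) * card (subspaces_of_dim scale d)
      = (\<Sum>X\<in>\<S>. card {g\<in>automorphisms. g ` X \<in> F} * card (subspaces_of_dim scale d))"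
    by (simp add: sum_distrib_right)
  also have "\<dots> = (\<Sum>X\<in>\<S>. card automorphisms * card {X\<in>F. dim X = d})"
  proof (rule sum.cong[OF refl])
    fix X assume "X \<in> \<S>"
    from S[OF this] have X: "subspace X" "dim X = d" by simp_all
    show "card {g\<in>automorphisms. g ` X \<in> F} * card (subspaces_of_dim scale d)
        = card automorphisms * card {X\<in>F. dim X = d}"
      using card_automorphisms_into[OF X(1) F] unfolding X(2) .
  qed
  finally show ?thesis by (simp add: mult.assoc)
qed

text \<open>Moving the family back, instead of the configuration forward, keeps the configuration
  fixed, so one weight bound serves all automorphisms.\<close>

definition pullback :: "('v \<Rightarrow> 'v) \<Rightarrow> 'v set set \<Rightarrow> 'v set set" where
  "pullback g F = {X. subspace X \<and> g ` X \<in> F}"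

text \<open>Records what the forbidden posets say about subspaces of a single dimension, which
  always form an antichain.\<close>

definition sparse :: "nat \<Rightarrow> nat \<Rightarrow> 'v set set \<Rightarrow> bool" where
  "sparse k l F \<longleftrightarrow> (\<forall>Y\<in>F. subspace Y \<and>
     (\<forall>d. card {X\<in>F. Y \<subset> X \<and> dim X = d} < k \<and> card {X\<in>F. X \<subset> Y \<and> dim X = d} < l))"

lemma sparse_pullback:
  assumes F: "sparse k l F" and g: "g \<in> automorphisms"
  shows "sparse k l (pullback g F)"
  unfolding sparse_def
proof (intro ballI allI conjI)
  fix Y d assume Y: "Y \<in> pullback g F"
  have psub: "g ` X \<subset> g ` Z \<longleftrightarrow> X \<subset> Z" for X Z
    by (simp only: psubset_eq automorphism_image_subset_iff[OF g] automorphism_image_eq_iff[OF g])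
  have inj: "inj_on ((`) g) S" for S
    using automorphism_image_eq_iff[OF g] by (simp add: inj_on_def)
  show "subspace Y" using Y by (simp add: pullback_def)
  have "card {X\<in>pullback g F. Y \<subset> X \<and> dim X = d} \<le> card {X\<in>F. g ` Y \<subset> X \<and> dim X = d}"
  proof (rule card_inj_on_le[OF inj image_subsetI])
    fix X assume "X \<in> {X\<in>pullback g F. Y \<subset> X \<and> dim X = d}"
    thus "g ` X \<in> {X\<in>F. g ` Y \<subset> X \<and> dim X = d}"
      using g by (simp only: mem_Collect_eq pullback_def psub dim_automorphism_image simp_thms)
  qed simp
  also have "\<dots> < k" using F Y by (simp add: sparse_def pullback_def)
  finally show "card {X\<in>pullback g F. Y \<subset> X \<and> dim X = d} < k" .
  have "card {X\<in>pullback g F. X \<subset> Y \<and> dim X = d} \<le> card {X\<in>F. X \<subset> g ` Y \<and> dim X = d}"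
  proof (rule card_inj_on_le[OF inj image_subsetI])
    fix X assume "X \<in> {X\<in>pullback g F. X \<subset> Y \<and> dim X = d}"
    thus "g ` X \<in> {X\<in>F. X \<subset> g ` Y \<and> dim X = d}"
      using g by (simp only: mem_Collect_eq pullback_def psub dim_automorphism_image simp_thms)
  qed simp
  also have "\<dots> < l" using F Y by (simp add: sparse_def pullback_def)
  finally show "card {X\<in>pullback g F. X \<subset> Y \<and> dim X = d} < l" .
qed

end

section \<open>The weighted configuration\<close>

text \<open>A rational bound that keeps later estimates linear.\<close>

lemma sqrt2_coefficient: "1 - sqrt 2 / 2 < (3 :: real) / 10"
proof -
  have "1.4 < sqrt (2 :: real)" by (rule real_less_rsqrt) (simp add: power2_eq_square)
  thus ?thesis by simp
qed

text \<open>This yields \<open>q\<^sup>2 - 1 \<ge> 15\<close>, the constant in the bound for the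
  outer levels.\<close>

lemma q_gt_3:
  assumes "k \<ge> 1" "real k \<le> (1 - sqrt 2 / 2) * real q"
  shows "q > 3"
proof -
  have "(1 - sqrt 2 / 2) * real q \<le> 3 / 10 * real q"
    using sqrt2_coefficient by (intro mult_right_mono) auto
  hence "real k \<le> 3 / 10 * real q" using assms(2) by linarith
  thus ?thesis using assms(1) by linarith
qed

text \<open>The form \<open>Suc (dim U) = m\<close> avoids truncated subtraction and forces
  \<open>m \<ge> 1\<close>. The \<open>c i\<close> are related only to \<open>U\<close> and
  \<open>W\<close>, not to one another: what matters is that each is comparable with every subspace
  between \<open>U\<close> and \<open>W\<close>.\<close>

locale flag_with_plane = finite_vector_space scale Basis q
  for scale :: "'a::{field,finite} \<Rightarrow> 'v::ab_group_add \<Rightarrow> 'v" (infixr \<open>*s\<close> 75)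
    and Basis :: "'v set" and q :: nat +
  fixes m :: nat and U W :: "'v set" and c :: "nat \<Rightarrow> 'v set"
  assumes dimension: "dimension = 2 * m + 1"
    and subspace_U: "subspace U" and subspace_W: "subspace W" and U_subset_W: "U \<subseteq> W"
    and dim_U: "Suc (dim U) = m" and dim_W: "dim W = m + 2"
    and below: "i < m \<Longrightarrow> subspace (c i) \<and> c i \<subseteq> U \<and> dim (c i) = i"
    and above: "m + 2 \<le> i \<Longrightarrow> i \<le> 2 * m + 1 \<Longrightarrow> subspace (c i) \<and> W \<subseteq> c i \<and> dim (c i) = i"
begin

definition points :: "'v set set" where
  "points = {X. subspace X \<and> U \<subseteq> X \<and> X \<subseteq> W \<and> dim X = m}"

definition lines :: "'v set set" where
  "lines = {X. subspace X \<and> U \<subseteq> X \<and> X \<subseteq> W \<and> dim X = Suc m}"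

definition outer :: "nat set" where
  "outer = {..<m} \<union> {Suc m<..2 * m + 1}"

text \<open>Each dimension is weighted so that the mean over all automorphisms \<open>g\<close> of the weight of
  \<open>pullback g F\<close> is \<open>card F\<close>; recall that the dimensions \<open>m\<close> and \<open>m + 1\<close> have equally many subspaces.\<close>

definition weight :: "'v set set \<Rightarrow> real" where
  "weight F = (\<Sum>i\<in>outer. level_size i * of_bool (c i \<in> F))
     + level_size m / (q\<^sup>2 + q + 1) * (card (points \<inter> F) + card (lines \<inter> F))"

lemma rank_plane: "dim W = dim U + 3"
  using dim_U dim_W by simp

lemma card_points: "card points = q\<^sup>2 + q + 1"
  using card_points_rank3[OF subspace_U subspace_W U_subset_W rank_plane]
  unfolding points_def dim_U .

lemma card_lines: "card lines = q\<^sup>2 + q + 1"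
proof -
  have "Suc m = dim U + 2" using dim_U by simp
  thus ?thesis unfolding lines_def
    by (simp only: card_lines_rank3[OF subspace_U subspace_W U_subset_W rank_plane])
qed

lemma card_lines_through:
  assumes p: "p \<in> points"
  shows "card {l\<in>lines. p \<subseteq> l} = q + 1"
proof -
  have p': "subspace p" "U \<subseteq> p" "p \<subseteq> W" "dim p = m" using p by (simp_all add: points_def)
  have "{l\<in>lines. p \<subseteq> l} = {X. subspace X \<and> p \<subseteq> X \<and> X \<subseteq> W \<and> dim X = Suc (dim p)}"
    using p' by (auto simp: lines_def)
  moreover have "dim W = dim p + 2" using p' dim_W by simp
  ultimately show ?thesis using card_between_rank2[OF p'(1) subspace_W p'(3)] by (simp only:)
qed

lemma card_points_on:
  assumes l: "l \<in> lines"
  shows "card {p\<in>points. p \<subseteq> l} = q + 1"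
proof -
  have l': "subspace l" "U \<subseteq> l" "l \<subseteq> W" "dim l = Suc m" using l by (simp_all add: lines_def)
  have "{p\<in>points. p \<subseteq> l} = {X. subspace X \<and> U \<subseteq> X \<and> X \<subseteq> l \<and> dim X = Suc (dim U)}"
    unfolding dim_U using l' by (auto simp: points_def)
  moreover have "dim l = dim U + 2" using l' dim_U by simp
  ultimately show ?thesis using card_between_rank2[OF subspace_U l'(1,2)] by (simp only:)
qed

lemma point_neq_line: "p \<in> points \<Longrightarrow> l \<in> lines \<Longrightarrow> p \<noteq> l"
  by (auto simp: points_def lines_def)

lemma plane_bound_sparse:
  assumes F: "sparse k l F"
    and k: "real k \<le> (1 - sqrt 2 / 2) * real q" and l: "real l \<le> (1 - sqrt 2 / 2) * real q"
    and "points \<inter> F \<noteq> {}" "lines \<inter> F \<noteq> {}"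
  shows "card (points \<inter> F) + card (lines \<inter> F) < q\<^sup>2 + q + 1"
proof (rule plane_bound[where P = points and L = lines and inc = "(\<subseteq>)" and k = k and l = l])
  fix x x' y y' assume *: "x \<in> points" "x' \<in> points" "x \<noteq> x'" "y \<in> lines" "y' \<in> lines"
    "x \<subseteq> y" "x' \<subseteq> y" "x \<subseteq> y'" "x' \<subseteq> y'"
  show "y = y'"
    by (rule line_through_points_unique[where p = x and p' = x' and d = m])
      (use * in \<open>simp_all add: points_def lines_def\<close>)
next
  fix x assume x: "x \<in> points \<inter> F"
  have "card {y\<in>lines \<inter> F. x \<subseteq> y} \<le> card {X\<in>F. x \<subset> X \<and> dim X = Suc m}"
  proof (intro card_mono subsetI)
    fix X assume "X \<in> {y\<in>lines \<inter> F. x \<subseteq> y}"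
    thus "X \<in> {X\<in>F. x \<subset> X \<and> dim X = Suc m}"
      using x point_neq_line[of x X] by (simp add: lines_def psubset_eq)
  qed simp
  also have "\<dots> < k" using F x by (simp add: sparse_def)
  finally show "card {y\<in>lines \<inter> F. x \<subseteq> y} < k" .
next
  fix y assume y: "y \<in> lines \<inter> F"
  have "card {x\<in>points \<inter> F. x \<subseteq> y} \<le> card {X\<in>F. X \<subset> y \<and> dim X = m}"
  proof (intro card_mono subsetI)
    fix X assume "X \<in> {x\<in>points \<inter> F. x \<subseteq> y}"
    thus "X \<in> {X\<in>F. X \<subset> y \<and> dim X = m}"
      using y point_neq_line[of X y] by (simp add: points_def psubset_eq)
  qed simp
  also have "\<dots> < l" using F y by (simp add: sparse_def)
  finally show "card {x\<in>points \<inter> F. x \<subseteq> y} < l" .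
qed (simp_all only: k l card_points card_lines card_lines_through card_points_on inf_le1
    finite_vector_families assms(4,5) not_False_eq_True)

text \<open>Each side of the middle contributes at most one fifteenth of its adjacent middle level,
  and the two middle levels have equal size.\<close>

lemma sum_outer_level_size:
  assumes "q > 3"
  shows "15 * (\<Sum>i\<in>outer. level_size i) \<le> 2 * level_size m"
proof -
  have q: "15 \<le> (real q)\<^sup>2 - 1"
    using power_mono[of 4 "real q" 2] assms by simp
  have *: "15 * x \<le> y" if "((real q)\<^sup>2 - 1) * x \<le> y" "x \<ge> 0" for x y :: real
    using mult_right_mono[OF q that(2)] that(1) by linarith
  have "15 * (\<Sum>i<m. level_size i) \<le> level_size m"
    by (intro * sum_level_size_below sum_nonneg) (use dimension in auto)
  moreover have "15 * (\<Sum>i\<in>{Suc m<..2 * m + 1}. level_size i) \<le> level_size (Suc m)"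
    using sum_level_size_above[of m "Suc m"] dimension by (intro * sum_nonneg) auto
  moreover have "(\<Sum>i\<in>outer. level_size i)
      = (\<Sum>i<m. level_size i) + (\<Sum>i\<in>{Suc m<..2 * m + 1}. level_size i)"
    unfolding outer_def by (intro sum.union_disjoint) auto
  ultimately show ?thesis using level_size_middle[OF dimension] by simp
qed

text \<open>An outer member of \<open>F\<close> lies below or above all points and lines, so fewer
  than \<open>k\<close>, respectively fewer than \<open>l\<close>, of each kind are in
  \<open>F\<close>. The plane then contributes at most half of \<open>level_size m\<close>, and the
  outer dimensions at most 2/15 of it.\<close>

lemma weight_less_if_outer:
  assumes F: "sparse k l F" and k1: "k \<ge> 1"
    and k: "real k \<le> (1 - sqrt 2 / 2) * real q" and l: "real l \<le> (1 - sqrt 2 / 2) * real q"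
    and i: "i \<in> outer" "c i \<in> F"
  shows "weight F < level_size m"
proof -
  define Q where "Q = real q ^ 2 + real q + 1"
  define N where "N = level_size m"
  have q: "q > 3" using q_gt_3[OF k1 k] .
  have N: "N > 0" unfolding N_def using dimension by (intro level_size_pos) simp
  have Q: "Q > 0" unfolding Q_def using q by (simp add: add_pos_pos)
  have few: "10 * real (card {X\<in>F. U \<subseteq> X \<and> X \<subseteq> W \<and> dim X = d}) \<le> 3 * real q"
    if d: "d \<in> {m, Suc m}" for d
  proof -
    have "real (card {X\<in>F. U \<subseteq> X \<and> X \<subseteq> W \<and> dim X = d}) \<le> (1 - sqrt 2 / 2) * real q"
    proof (cases "i < m")
      case True
      hence "c i \<subseteq> U" "dim (c i) = i" using below by auto
      hence "card {X\<in>F. U \<subseteq> X \<and> X \<subseteq> W \<and> dim X = d} \<le> card {X\<in>F. c i \<subset> X \<and> dim X = d}"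
        using d True by (intro card_mono) auto
      also have "\<dots> < k" using F i by (simp add: sparse_def)
      finally show ?thesis using k by linarith
    next
      case False
      hence "m + 2 \<le> i" "i \<le> 2 * m + 1" using i by (auto simp: outer_def)
      hence "W \<subseteq> c i" "dim (c i) = i" using above by auto
      hence "card {X\<in>F. U \<subseteq> X \<and> X \<subseteq> W \<and> dim X = d} \<le> card {X\<in>F. X \<subset> c i \<and> dim X = d}"
        using d \<open>m + 2 \<le> i\<close> by (intro card_mono) auto
      also have "\<dots> < l" using F i by (simp add: sparse_def)
      finally show ?thesis using l by linarith
    qed
    moreover have "(1 - sqrt 2 / 2) * real q \<le> 3 / 10 * real q"
      using sqrt2_coefficient by (intro mult_right_mono) auto
    ultimately show ?thesis by linarith
  qed
  have "card (points \<inter> F) \<le> card {X\<in>F. U \<subseteq> X \<and> X \<subseteq> W \<and> dim X = m}"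
    by (intro card_mono) (auto simp: points_def)
  moreover have "card (lines \<inter> F) \<le> card {X\<in>F. U \<subseteq> X \<and> X \<subseteq> W \<and> dim X = Suc m}"
    by (intro card_mono) (auto simp: lines_def)
  ultimately have "10 * (real (card (points \<inter> F)) + real (card (lines \<inter> F))) \<le> 6 * real q"
    using few[of m] few[of "Suc m"] by simp
  \<comment> \<open>The crude factor 1/2 already leaves room for the outer contribution.\<close>
  also have "\<dots> \<le> 5 * Q"
  proof -
    have "real q * 1 \<le> real q * real q" using q by (intro mult_left_mono) auto
    thus ?thesis unfolding Q_def power2_eq_square distrib_left by linarith
  qed
  finally have "real (card (points \<inter> F)) + real (card (lines \<inter> F)) \<le> Q / 2" by simp
  hence "N / Q * (real (card (points \<inter> F)) + real (card (lines \<inter> F))) \<le> N / Q * (Q / 2)"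
    using N Q by (intro mult_left_mono) auto
  hence plane: "N / Q * (real (card (points \<inter> F)) + real (card (lines \<inter> F))) \<le> N / 2"
    using Q by simp
  have "(\<Sum>i\<in>outer. level_size i * of_bool (c i \<in> F)) \<le> (\<Sum>i\<in>outer. level_size i)"
    by (intro sum_mono) auto
  hence "15 * (\<Sum>i\<in>outer. level_size i * of_bool (c i \<in> F)) \<le> 2 * N"
    using sum_outer_level_size[OF q] unfolding N_def by linarith
  moreover have "weight F = (\<Sum>i\<in>outer. level_size i * of_bool (c i \<in> F))
      + N / Q * (real (card (points \<inter> F)) + real (card (lines \<inter> F)))"
    by (simp add: weight_def Q_def N_def)
  ultimately show ?thesis
    using plane N unfolding N_def by linarith
qed

text \<open>If some outer \<open>c i\<close> is in \<open>F\<close>, the weight is strictly smaller.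
  Otherwise it is proportional to the number \<open>s\<close> of points and lines in
  \<open>F\<close>, which is at most the size of the plane by \<open>plane_bound_sparse\<close>, or
  trivially if one kind is absent.\<close>

lemma weight_le:
  assumes F: "sparse k l F" and k1: "k \<ge> 1"
    and k: "real k \<le> (1 - sqrt 2 / 2) * real q" and l: "real l \<le> (1 - sqrt 2 / 2) * real q"
  shows "weight F \<le> level_size m"
    and "weight F = level_size m \<Longrightarrow> (\<forall>i\<in>outer. c i \<notin> F) \<and>
      (points \<subseteq> F \<and> lines \<inter> F = {} \<or> lines \<subseteq> F \<and> points \<inter> F = {})"
proof -
  define Q where "Q = q\<^sup>2 + q + 1"
  define s where "s = card (points \<inter> F) + card (lines \<inter> F)"
  have N: "level_size m > 0" using dimension by (intro level_size_pos) simp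
  have Q: "Q > 0" unfolding Q_def by simp
  have le: "card (points \<inter> F) \<le> Q" "card (lines \<inter> F) \<le> Q"
    unfolding Q_def
    using card_mono[OF finite_vector_families inf_le1, of points F]
      card_mono[OF finite_vector_families inf_le1, of lines F]
    by (simp_all only: card_points card_lines)
  have s_le: "s \<le> Q"
  proof (cases "points \<inter> F = {} \<or> lines \<inter> F = {}")
    case True
    thus ?thesis using le unfolding s_def by (elim disjE) simp_all
  next
    case False
    thus ?thesis using plane_bound_sparse[OF F k l] unfolding s_def Q_def by linarith
  qed
  have weight_eq: "weight F = level_size m * (real s / real Q)" if "\<forall>i\<in>outer. c i \<notin> F"
    using that by (simp add: weight_def Q_def s_def)
  have "weight F \<le> level_size m \<and> (weight F = level_size m \<longrightarrow> (\<forall>i\<in>outer. c i \<notin> F) \<and> s = Q)"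
  proof (cases "\<forall>i\<in>outer. c i \<notin> F")
    case True
    have "real s / real Q \<le> 1" using s_le Q by simp
    hence "level_size m * (real s / real Q) \<le> level_size m * 1"
      using N by (intro mult_left_mono) auto
    moreover have "s = Q" if "level_size m * (real s / real Q) = level_size m"
    proof -
      have "real s / real Q = 1" using that N by (simp only: mult_cancel_left2) linarith
      thus ?thesis using Q by simp
    qed
    ultimately show ?thesis using weight_eq[OF True] True by simp
  next
    case False
    then obtain i where "i \<in> outer" "c i \<in> F" by blast
    from weight_less_if_outer[OF F k1 k l this] show ?thesis by simp
  qed
  \<comment> \<open>Equality excludes the mixed case, so one kind is absent and the other is present
    completely.\<close>
  moreover have "points \<subseteq> F \<and> lines \<inter> F = {} \<or> lines \<subseteq> F \<and> points \<inter> F = {}" if "s = Q"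
  proof -
    have "points \<inter> F = {} \<or> lines \<inter> F = {}"
      using plane_bound_sparse[OF F k l] that unfolding s_def Q_def by linarith
    moreover have "S \<subseteq> F" if "card (S \<inter> F) = card S" for S :: "'v set set"
      using card_subset_eq[of S "S \<inter> F"] that by auto
    ultimately show ?thesis
      using that unfolding s_def Q_def card_points[symmetric]
      by (metis add_0 add_0_right card.empty card_lines card_points)
  qed
  ultimately show "weight F \<le> level_size m"
    and "weight F = level_size m \<Longrightarrow> (\<forall>i\<in>outer. c i \<notin> F) \<and>
      (points \<subseteq> F \<and> lines \<inter> F = {} \<or> lines \<subseteq> F \<and> points \<inter> F = {})"
    by blast+
qed

text \<open>A fixed subspace of dimension \<open>d\<close> is carried into \<open>F\<close> with
  probability \<open>f d / level_size d\<close>. The weights cancel these denominators, so each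
  dimension contributes \<open>f d\<close> on average.\<close>

lemma sum_weight_pullback:
  assumes F: "\<And>X. X \<in> F \<Longrightarrow> subspace X"
  shows "(\<Sum>g\<in>automorphisms. weight (pullback g F)) = real (card automorphisms) * real (card F)"
proof -
  define f where "f d = real (card {X\<in>F. dim X = d})" for d
  define G where "G = real (card automorphisms)"
  have N: "level_size d > 0" if "d \<le> dimension" for d
    using that by (rule level_size_pos)
  have "card F = (\<Sum>d\<le>dimension. card {X\<in>F. dim X = d})"
  proof -
    have "F = (\<Union>d\<in>{..dimension}. {X\<in>F. dim X = d})"
      using dim_le_dimension by auto
    hence "card F = card (\<Union>d\<in>{..dimension}. {X\<in>F. dim X = d})" by simp
    also have "\<dots> = (\<Sum>d\<le>dimension. card {X\<in>F. dim X = d})"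
      by (rule card_UN_disjoint) auto
    finally show ?thesis .
  qed
  hence card_F: "real (card F) = (\<Sum>d\<le>dimension. f d)" by (simp add: f_def)
  have uniform: "(\<Sum>g\<in>automorphisms. real (card (S \<inter> pullback g F))) * level_size d = card S * G * f d"
    if S: "\<And>X. X \<in> S \<Longrightarrow> subspace X \<and> dim X = d" for S d
  proof -
    have "S \<inter> pullback g F = {X\<in>S. g ` X \<in> F}" for g
      using S by (auto simp: pullback_def)
    moreover have "(\<Sum>g\<in>automorphisms. card {X\<in>S. g ` X \<in> F}) * card (subspaces_of_dim scale d)
         = card S * card automorphisms * card {X\<in>F. dim X = d}"
      using S F by (rule sum_card_automorphisms_into)
    ultimately show ?thesis
      unfolding f_def G_def by (simp flip: of_nat_sum of_nat_mult)
  qed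
  have single: "(\<Sum>g\<in>automorphisms. level_size i * of_bool (c i \<in> pullback g F)) = G * f i"
    if i: "i \<in> outer" for i
  proof -
    have "subspace (c i)" "dim (c i) = i"
      using i below above by (auto simp: outer_def)
    hence "(\<Sum>g\<in>automorphisms. real (card ({c i} \<inter> pullback g F))) * level_size i = G * f i"
      using uniform[of "{c i}" i] by simp
    moreover have "real (card ({c i} \<inter> pullback g F)) = of_bool (c i \<in> pullback g F)" for g
      by simp
    ultimately show ?thesis by (simp add: mult.commute flip: sum_distrib_left)
  qed
  \<comment> \<open>The plane has \<open>q\<^sup>2 + q + 1\<close> subspaces of the dimension in
    question, hence this denominator in the weight.\<close>
  have plane: "(\<Sum>g\<in>automorphisms. level_size m / (q\<^sup>2 + q + 1) * real (card (S \<inter> pullback g F))) = G * f d"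
    if S: "\<And>X. X \<in> S \<Longrightarrow> subspace X \<and> dim X = d" "card S = q\<^sup>2 + q + 1" "level_size d = level_size m"
    for S d
  proof -
    define R where "R = real (q\<^sup>2 + q + 1)"
    have R: "R > 0" unfolding R_def of_nat_0_less_iff by simp
    have "(\<Sum>g\<in>automorphisms. real (card (S \<inter> pullback g F))) * level_size m = R * (G * f d)"
      using uniform[of S d, OF S(1)] unfolding S(2,3) R_def by simp
    hence "level_size m / R * (\<Sum>g\<in>automorphisms. real (card (S \<inter> pullback g F))) = G * f d"
      using R by (simp add: field_simps)
    thus ?thesis unfolding R_def by (simp add: sum_distrib_left)
  qed
  have "(\<Sum>g\<in>automorphisms. weight (pullback g F))
      = (\<Sum>i\<in>outer. \<Sum>g\<in>automorphisms. level_size i * of_bool (c i \<in> pullback g F))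
        + (\<Sum>g\<in>automorphisms. level_size m / (q\<^sup>2 + q + 1) * real (card (points \<inter> pullback g F)))
        + (\<Sum>g\<in>automorphisms. level_size m / (q\<^sup>2 + q + 1) * real (card (lines \<inter> pullback g F)))"
    unfolding weight_def sum.distrib distrib_left of_nat_add
    by (subst sum.swap) (rule add.assoc[symmetric])
  also have "\<dots> = (\<Sum>i\<in>outer. G * f i) + G * f m + G * f (Suc m)"
  proof -
    have "(\<Sum>i\<in>outer. \<Sum>g\<in>automorphisms. level_size i * of_bool (c i \<in> pullback g F))
        = (\<Sum>i\<in>outer. G * f i)"
      by (rule sum.cong[OF refl single])
    moreover have "(\<Sum>g\<in>automorphisms. level_size m / (q\<^sup>2 + q + 1) * real (card (points \<inter> pullback g F))) = G * f m"
      by (rule plane[OF _ card_points refl]) (simp add: points_def)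
    moreover have "(\<Sum>g\<in>automorphisms. level_size m / (q\<^sup>2 + q + 1) * real (card (lines \<inter> pullback g F))) = G * f (Suc m)"
      by (rule plane[OF _ card_lines level_size_middle[OF dimension]]) (simp add: lines_def)
    ultimately show ?thesis by (simp only:)
  qed
  also have "\<dots> = G * (\<Sum>d\<in>insert m (insert (Suc m) outer). f d)"
  proof -
    have "finite outer" "m \<notin> insert (Suc m) outer" "Suc m \<notin> outer" by (auto simp: outer_def)
    thus ?thesis by (simp add: sum_distrib_left distrib_left)
  qed
  also have "insert m (insert (Suc m) outer) = {..dimension}"
    unfolding dimension outer_def by auto
  finally show ?thesis unfolding card_F G_def .
qed

text \<open>The mean of the weights is at most their maximum. In the case of equality every pullback
  has maximal weight, so the description of equality in \<open>weight_le\<close> holds for all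
  automorphisms.\<close>

lemma card_sparse_le:
  assumes F: "sparse k l F" and k1: "k \<ge> 1"
    and k: "real k \<le> (1 - sqrt 2 / 2) * real q" and l: "real l \<le> (1 - sqrt 2 / 2) * real q"
  shows "real (card F) \<le> level_size m"
    and "real (card F) = level_size m \<Longrightarrow> X \<in> F \<Longrightarrow> dim X \<in> {m, Suc m}"
    and "real (card F) = level_size m \<Longrightarrow>
      points \<subseteq> F \<and> lines \<inter> F = {} \<or> lines \<subseteq> F \<and> points \<inter> F = {}"
proof -
  have sub: "subspace X" if "X \<in> F" for X using F that by (simp add: sparse_def)
  have G: "real (card automorphisms) > 0"
    using finite_automorphisms id_in_automorphisms by (auto simp: card_gt_0_iff)
  have le: "weight (pullback g F) \<le> level_size m" if "g \<in> automorphisms" for g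
    by (rule weight_le[OF sparse_pullback[OF F that] k1 k l])
  have "(\<Sum>g\<in>automorphisms. weight (pullback g F)) \<le> (\<Sum>g\<in>automorphisms. level_size m)"
    by (rule sum_mono[OF le])
  hence "real (card automorphisms) * real (card F) \<le> real (card automorphisms) * level_size m"
    using sum_weight_pullback[of F] sub by simp
  thus "real (card F) \<le> level_size m" using G by simp
  assume eq: "real (card F) = level_size m"
  have "weight (pullback g F) = level_size m" if "g \<in> automorphisms" for g
  proof (rule sum_mono_inv[OF _ le that finite_automorphisms])
    show "(\<Sum>g\<in>automorphisms. weight (pullback g F)) = (\<Sum>g\<in>automorphisms. level_size m)"
      using sum_weight_pullback[of F] sub eq by simp
  qed
  hence extremal: "(\<forall>i\<in>outer. c i \<notin> pullback g F) \<and>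
      (points \<subseteq> pullback g F \<and> lines \<inter> pullback g F = {} \<or>
       lines \<subseteq> pullback g F \<and> points \<inter> pullback g F = {})" if "g \<in> automorphisms" for g
    using weight_le(2)[OF sparse_pullback[OF F that] k1 k l] that by blast
  \<comment> \<open>The identity recovers the given plane itself.\<close>
  have "pullback id F = F" using sub by (auto simp: pullback_def)
  thus "points \<subseteq> F \<and> lines \<inter> F = {} \<or> lines \<subseteq> F \<and> points \<inter> F = {}"
    using extremal[OF id_in_automorphisms] by simp
  assume X: "X \<in> F"
  show "dim X \<in> {m, Suc m}"
  proof (rule ccontr)
    assume "dim X \<notin> {m, Suc m}"
    hence outer: "dim X \<in> outer"
      using dim_le_dimension[of X] dimension by (auto simp: outer_def)
    hence "subspace (c (dim X))" "dim (c (dim X)) = dim X"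
      using below above by (auto simp: outer_def)
    \<comment> \<open>A member of outer dimension is the image of the configuration member of that
      dimension, which would then lie in the pullback.\<close>
    then obtain g where g: "g \<in> automorphisms" "g ` c (dim X) = X"
      using exists_automorphism[of "c (dim X)" X] sub[OF X] by blast
    hence "c (dim X) \<in> pullback g F"
      using X \<open>subspace (c (dim X))\<close> by (simp add: pullback_def)
    thus False using extremal[OF g(1)] outer by blast
  qed
qed

end

section \<open>Extremal families\<close>

context finite_vector_space
begin
text \<open>Every pair \<open>U\<close>, \<open>W\<close> of the right dimensions can be completed
  to a configuration, so the last claim holds in all planes: one point of a plane in
  \<open>F\<close> forces all its points into \<open>F\<close>.\<close>

lemma card_sparse_le_middle_level:
  assumes dimension: "dimension = 2 * m + 1" and "m \<ge> 1"
    and F: "sparse k l F" and k1: "k \<ge> 1"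
    and k: "real k \<le> (1 - sqrt 2 / 2) * real q" and l: "real l \<le> (1 - sqrt 2 / 2) * real q"
  shows "card F \<le> card (subspaces_of_dim scale m)"
    and "card F = card (subspaces_of_dim scale m) \<Longrightarrow> X \<in> F \<Longrightarrow> dim X \<in> {m, Suc m}"
    and "card F = card (subspaces_of_dim scale m) \<Longrightarrow>
      subspace U \<Longrightarrow> subspace W \<Longrightarrow> U \<subseteq> W \<Longrightarrow> Suc (dim U) = m \<Longrightarrow> dim W = m + 2 \<Longrightarrow>
      subspace A \<Longrightarrow> subspace B \<Longrightarrow> U \<subseteq> A \<Longrightarrow> A \<subseteq> W \<Longrightarrow> U \<subseteq> B \<Longrightarrow> B \<subseteq> W \<Longrightarrow>
      dim A = m \<Longrightarrow> dim B = m \<Longrightarrow> A \<in> F \<Longrightarrow> B \<in> F"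
proof -
  have plane: "\<exists>c. flag_with_plane scale Basis q m U W c"
    if UW: "subspace U" "subspace W" "U \<subseteq> W" "Suc (dim U) = m" "dim W = m + 2" for U W
  proof -
    have "\<exists>X. (i < m \<longrightarrow> subspace X \<and> X \<subseteq> U \<and> dim X = i) \<and>
        (m + 2 \<le> i \<and> i \<le> 2 * m + 1 \<longrightarrow> subspace X \<and> W \<subseteq> X \<and> dim X = i)" for i
    proof (cases "i < m")
      case True
      then obtain X where "subspace X" "X \<subseteq> U" "dim X = i"
        using exists_subspace_between[of "{0}" U i] UW subspace_0[OF UW(1)] by auto
      thus ?thesis using True by auto
    next
      case False
      show ?thesis
      proof (cases "m + 2 \<le> i \<and> i \<le> 2 * m + 1")
        case True
        then obtain X where "subspace X" "W \<subseteq> X" "dim X = i"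
          using exists_subspace_between[of W UNIV i] UW dimension dimension_def by auto
        thus ?thesis using False by auto
      qed (use False in auto)
    qed
    then obtain c where "\<forall>i. (i < m \<longrightarrow> subspace (c i) \<and> c i \<subseteq> U \<and> dim (c i) = i) \<and>
        (m + 2 \<le> i \<and> i \<le> 2 * m + 1 \<longrightarrow> subspace (c i) \<and> W \<subseteq> c i \<and> dim (c i) = i)"
      by metis
    hence "flag_with_plane scale Basis q m U W c"
      using UW dimension by unfold_locales auto
    thus ?thesis by blast
  qed
  \<comment> \<open>The first two claims mention no plane, so any one will do;
    \<open>m \<ge> 1\<close> makes room for it.\<close>
  obtain W0 where W0: "subspace W0" "dim W0 = m + 2"
    using exists_subspace_between[of "{0}" UNIV "m + 2"] dimension dimension_def assms(2) by auto
  have "{0} \<subseteq> W0" "dim {0} \<le> m - 1" "m - 1 \<le> dim W0"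
    using subspace_0[OF W0(1)] W0(2) by simp_all
  from exists_subspace_between[OF subspace_single_0 W0(1) this]
  obtain U0 where U0: "subspace U0" "U0 \<subseteq> W0" "dim U0 = m - 1" by metis
  obtain c where c: "flag_with_plane scale Basis q m U0 W0 c"
    using plane[OF U0(1) W0(1) U0(2) _ W0(2)] U0(3) assms(2) by auto
  interpret P: flag_with_plane scale Basis q m U0 W0 c by (rule c)
  show "card F \<le> card (subspaces_of_dim scale m)"
    using P.card_sparse_le(1)[OF F k1 k l] by simp
  show "dim X \<in> {m, Suc m}" if "card F = card (subspaces_of_dim scale m)" "X \<in> F"
    using P.card_sparse_le(2)[OF F k1 k l] that by simp
  assume *: "card F = card (subspaces_of_dim scale m)" "subspace U" "subspace W" "U \<subseteq> W"
    "Suc (dim U) = m" "dim W = m + 2" "subspace A" "subspace B" "U \<subseteq> A" "A \<subseteq> W" "U \<subseteq> B" "B \<subseteq> W"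
    "dim A = m" "dim B = m" "A \<in> F"
  obtain c' where c': "flag_with_plane scale Basis q m U W c'"
    using plane[OF *(2-6)] by blast
  interpret Q: flag_with_plane scale Basis q m U W c' by (rule c')
  \<comment> \<open>Since \<open>A\<close> is a point in \<open>F\<close>, the alternative without
    points is impossible.\<close>
  have "A \<in> Q.points" "B \<in> Q.points" using * by (simp_all add: Q.points_def)
  thus "B \<in> F" using Q.card_sparse_le(3)[OF F k1 k l] * by auto
qed

text \<open>Connectedness of the Grassmann graph: \<open>A\<close> is moved towards \<open>B\<close>
  by exchanging one dimension at a time inside a plane, and the intersection with \<open>B\<close>
  grows at each step.\<close>

lemma subspaces_exchange_induct:
  assumes dimension: "dimension = 2 * m + 1"
    and step: "\<And>U W A B. subspace U \<Longrightarrow> subspace W \<Longrightarrow> U \<subseteq> W \<Longrightarrow> Suc (dim U) = m \<Longrightarrow> dim W = m + 2 \<Longrightarrow>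
      subspace A \<Longrightarrow> subspace B \<Longrightarrow> U \<subseteq> A \<Longrightarrow> A \<subseteq> W \<Longrightarrow> U \<subseteq> B \<Longrightarrow> B \<subseteq> W \<Longrightarrow>
      dim A = m \<Longrightarrow> dim B = m \<Longrightarrow> A \<in> F \<Longrightarrow> B \<in> F"
    and "A \<in> F" and "subspace A" "dim A = m" and B: "subspace B" "dim B = m"
  shows "B \<in> F"
  using assms(3-5)
proof (induction "m - dim (A \<inter> B)" arbitrary: A rule: less_induct)
  case less
  show ?case
  proof (cases "A = B")
    case False
    have sub_AB: "subspace (A \<inter> B)" using less.prems B by (simp add: subspace_inter)
    have not_sub: "\<not> B \<subseteq> A" "\<not> A \<subseteq> B"
      using False less.prems B subspace_dim_equal[of B A] subspace_dim_equal[of A B] by auto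
    hence dim_AB: "dim (A \<inter> B) < m"
      using dim_less[OF sub_AB less.prems(2)] less.prems by blast
    obtain v where v: "v \<in> B" "v \<notin> A" using not_sub by blast
    have "dim (A \<inter> B) \<le> m - 1" "m - 1 \<le> dim A" using dim_AB less.prems(3) by auto
    \<comment> \<open>The hyperplane \<open>H\<close> of \<open>A\<close> keeps all of
      \<open>A \<inter> B\<close>, so adjoining \<open>v \<in> B\<close> to it loses nothing already
      shared with \<open>B\<close>.\<close>
    from exists_subspace_between[OF sub_AB less.prems(2) Int_lower1 this]
    obtain H where H: "subspace H" "A \<inter> B \<subseteq> H" "H \<subseteq> A" "dim H = m - 1" by metis
    define A' where "A' = span (insert v H)"
    define T where "T = span (insert v A)"
    have A': "subspace A'" "dim A' = m" "H \<subseteq> A'" "v \<in> A'"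
      using dim_span_insert[OF H(1), of v] H v dim_AB subset_span_insert in_span_insert_self
      unfolding A'_def by auto
    have T: "subspace T" "dim T = Suc m" "A \<subseteq> T" "v \<in> T"
      using dim_span_insert[OF less.prems(2), of v] v less.prems subset_span_insert in_span_insert_self
      unfolding T_def by auto
    have "A' \<subseteq> T" unfolding A'_def using T H by (intro span_insert_subset) auto
    \<comment> \<open>\<open>T\<close> already contains \<open>A\<close> and \<open>A'\<close>; the
      extra dimension only completes the plane. It fits because \<open>dim_AB\<close> forces
      \<open>m \<ge> 1\<close>.\<close>
    obtain W where W: "subspace W" "T \<subseteq> W" "dim W = m + 2"
      using exists_subspace_between[OF T(1) subspace_UNIV, of "m + 2"] T dimension dim_AB dimension_def
      by auto
    have "A' \<in> F"
    proof (rule step[of H W A A'])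
      show "H \<subseteq> W" "A \<subseteq> W" "A' \<subseteq> W" using H T W \<open>A' \<subseteq> T\<close> by auto
    qed (use H W less.prems A' dim_AB in auto)
    moreover have "m - dim (A' \<inter> B) < m - dim (A \<inter> B)"
    proof -
      have "A \<inter> B \<subset> A' \<inter> B" using H A' v by auto
      hence "dim (A \<inter> B) < dim (A' \<inter> B)"
        by (rule dim_less[OF sub_AB subspace_inter[OF A'(1) B(1)]])
      thus ?thesis using dim_AB by linarith
    qed
    ultimately show ?thesis using less.hyps A' by blast
  qed (use less.prems in simp)
qed

text \<open>One member of dimension \<open>m\<close> forces the whole level into \<open>F\<close> by
  exchange. Without such a member, \<open>F\<close> lies in the level \<open>Suc m\<close>. Equal
  cardinalities finish both cases.\<close>

lemma maximum_sparse_eq_level: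
  assumes dimension: "dimension = 2 * m + 1" and m: "m \<ge> 1"
    and F: "sparse k l F" and k1: "k \<ge> 1"
    and k: "real k \<le> (1 - sqrt 2 / 2) * real q" and l: "real l \<le> (1 - sqrt 2 / 2) * real q"
    and card: "card F = card (subspaces_of_dim scale m)"
  shows "F = subspaces_of_dim scale m \<or> F = subspaces_of_dim scale (Suc m)"
proof (cases "\<exists>A\<in>F. dim A = m")
  case True
  then obtain A where A: "A \<in> F" "dim A = m" by blast
  have "subspaces_of_dim scale m \<subseteq> F"
  proof
    fix B assume "B \<in> subspaces_of_dim scale m"
    hence B: "subspace B" "dim B = m" by (simp_all add: subspaces_of_dim_def)
    show "B \<in> F"
    proof (rule subspaces_exchange_induct[OF dimension _ A(1) _ A(2) B])
      show "subspace A" using F A by (simp add: sparse_def)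
    qed (rule card_sparse_le_middle_level(3)[OF dimension m F k1 k l card])
  qed
  thus ?thesis using card card_subset_eq[of F "subspaces_of_dim scale m"] by simp
next
  case False
  have "F \<subseteq> subspaces_of_dim scale (Suc m)"
  proof
    fix X assume X: "X \<in> F"
    have "dim X \<in> {m, Suc m}"
      by (rule card_sparse_le_middle_level(2)[OF dimension m F k1 k l card X])
    thus "X \<in> subspaces_of_dim scale (Suc m)"
      using F X False by (auto simp: subspaces_of_dim_def sparse_def)
  qed
  moreover have "card F = card (subspaces_of_dim scale (Suc m))"
    using card level_size_middle[OF dimension] by simp
  ultimately show ?thesis
    using card_subset_eq[of "subspaces_of_dim scale (Suc m)" F] by simp
qed

section \<open>Free families, sparse families and the exceptional dimension\<close>

lemma sparse_if_free:
  assumes F: "F \<in> free_subspace_families scale {V_poset k, Lambda_poset l}"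
    and "k \<ge> 1" "l \<ge> 1"
  shows "sparse k l F"
  unfolding sparse_def
proof (intro ballI allI conjI)
  fix Y d assume Y: "Y \<in> F"
  have sub: "subspace X" if "X \<in> F" for X
    using F that by (simp add: free_subspace_families_def)
  have no_V: "\<not> induced_subposet (V_poset k) (relation_of (\<subseteq>) F)"
    and no_Lambda: "\<not> induced_subposet (Lambda_poset l) (relation_of (\<subseteq>) F)"
    using F by (simp_all add: free_subspace_families_def)
  have eq: "X = X'" if "X \<in> F" "X' \<in> F" "dim X = d" "dim X' = d" "X \<subseteq> X'" for X X'
    using that sub by (intro subspace_dim_equal) auto
  show "subspace Y" by (rule sub[OF Y])
  show "card {X\<in>F. Y \<subset> X \<and> dim X = d} < k"
  proof (rule ccontr)
    assume "\<not> ?thesis"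
    hence "induced_subposet (V_poset k) (relation_of (\<subseteq>) F)"
      using Y eq \<open>k \<ge> 1\<close>
      by (intro induced_V_posetI[where y = Y and S = "{X\<in>F. Y \<subset> X \<and> dim X = d}"])
        (auto simp: relation_of_def)
    thus False using no_V by contradiction
  qed
  show "card {X\<in>F. X \<subset> Y \<and> dim X = d} < l"
  proof (rule ccontr)
    assume "\<not> ?thesis"
    hence "induced_subposet (V_poset l) ((relation_of (\<subseteq>) F)\<inverse>)"
      using Y eq \<open>l \<ge> 1\<close>
      by (intro induced_V_posetI[where y = Y and S = "{X\<in>F. X \<subset> Y \<and> dim X = d}"])
        (auto simp: relation_of_def)
    thus False using no_Lambda by (simp add: induced_Lambda_poset_iff)
  qed
qed

text \<open>The lower bound: inclusion on a level is an identity relation, which equals its own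
  converse, so both posets are excluded alike.\<close>

lemma free_level:
  assumes "k \<ge> 1" "l \<ge> 1"
  shows "subspaces_of_dim scale d \<in> free_subspace_families scale {V_poset k, Lambda_poset l}"
proof -
  let ?F = "subspaces_of_dim scale d"
  have eq: "X = X'" if "X \<in> ?F" "X' \<in> ?F" "X \<subseteq> X'" for X X'
    using that by (intro subspace_dim_equal) (auto simp: subspaces_of_dim_def)
  hence rel: "relation_of (\<subseteq>) ?F = Id_on ?F"
    by (auto simp: relation_of_def)
  have "\<not> induced_subposet (V_poset j) (Id_on ?F)" if "j \<ge> 1" for j
    using that by (rule not_induced_V_poset_Id_on)
  hence "\<forall>P\<in>{V_poset k, Lambda_poset l}. \<not> induced_subposet P (relation_of (\<subseteq>) ?F)"
    using assms by (simp add: rel induced_Lambda_poset_iff)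
  moreover have "\<forall>X\<in>?F. subspace X" by (simp add: subspaces_of_dim_def)
  ultimately show ?thesis by (simp add: free_subspace_families_def)
qed

text \<open>Dimension 1 has no plane to average over. Its only subspaces are \<open>{0}\<close> and
  the whole space, and having both contradicts sparsity once \<open>k\<close> or \<open>l\<close> is
  1.\<close>

lemma maximum_sparse_dimension_1:
  assumes dimension: "dimension = 1" and F: "sparse k l F" and kl: "k = 1 \<or> l = 1"
  shows "card F \<le> card (subspaces_of_dim scale 0)"
    and "card F = card (subspaces_of_dim scale 0) \<Longrightarrow>
      F = subspaces_of_dim scale 0 \<or> F = subspaces_of_dim scale 1"
proof -
  have sub: "subspace X" if "X \<in> F" for X using F that by (simp add: sparse_def)
  have "F \<subseteq> subspaces_of_dim scale 0 \<or> F \<subseteq> subspaces_of_dim scale 1"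
  proof (rule ccontr)
    assume "\<not> ?thesis"
    then obtain A B where AB: "A \<in> F" "B \<in> F" "dim A \<noteq> 0" "dim B \<noteq> 1"
      using sub by (auto simp: subspaces_of_dim_def simp del: dim_eq_0)
    hence dims: "dim A = 1" "dim B = 0"
      using dim_le_dimension[of A] dim_le_dimension[of B] dimension by linarith+
    have "B \<subseteq> A"
      using dims(2) subspace_0[OF sub[OF AB(1)]] by auto
    moreover have "B \<noteq> A" using dims by (metis zero_neq_one)
    ultimately have "B \<subset> A" by (rule psubsetI)
    hence "A \<in> {X\<in>F. B \<subset> X \<and> dim X = 1}" "B \<in> {X\<in>F. X \<subset> A \<and> dim X = 0}"
      using AB dims by simp_all
    hence "card {X\<in>F. B \<subset> X \<and> dim X = 1} \<noteq> 0" "card {X\<in>F. X \<subset> A \<and> dim X = 0} \<noteq> 0"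
      unfolding card_0_eq[OF finite_vector_families] by blast+
    moreover have "card {X\<in>F. B \<subset> X \<and> dim X = 1} < k" "card {X\<in>F. X \<subset> A \<and> dim X = 0} < l"
      using F AB unfolding sparse_def by blast+
    ultimately show False using kl by linarith
  qed
  moreover have "card (subspaces_of_dim scale 1) = card (subspaces_of_dim scale 0)"
    using level_size_middle[of 0] dimension by simp
  ultimately obtain d where d: "d \<in> {0, 1}" "F \<subseteq> subspaces_of_dim scale d"
    "card (subspaces_of_dim scale d) = card (subspaces_of_dim scale 0)" by auto
  show "card F \<le> card (subspaces_of_dim scale 0)"
    using card_mono[OF finite_vector_families d(2)] d(3) by simp
  show "F = subspaces_of_dim scale 0 \<or> F = subspaces_of_dim scale 1"
    if "card F = card (subspaces_of_dim scale 0)"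
    using card_subset_eq[OF finite_vector_families d(2)] d(1,3) that by auto
qed

lemma maximum_sparse:
  assumes dimension: "dimension = 2 * m + 1"
    and F: "sparse k l F" and k1: "k \<ge> 1"
    and k: "real k \<le> (1 - sqrt 2 / 2) * real q" and l: "real l \<le> (1 - sqrt 2 / 2) * real q"
    and kl: "m = 0 \<Longrightarrow> k = 1 \<or> l = 1"
  shows "card F \<le> card (subspaces_of_dim scale m) \<and>
    (card F = card (subspaces_of_dim scale m) \<longrightarrow>
      F = subspaces_of_dim scale m \<or> F = subspaces_of_dim scale (Suc m))"
proof (cases "m = 0")
  case True
  thus ?thesis using maximum_sparse_dimension_1[OF _ F kl] dimension by simp
next
  case False
  hence m: "m \<ge> 1" by simp
  show ?thesis
    using card_sparse_le_middle_level(1)[OF dimension m F k1 k l]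
      maximum_sparse_eq_level[OF dimension m F k1 k l] by blast
qed

end

text \<open>For \<open>k = 0\<close> the poset \<open>V_poset k\<close> is a single element and only
  the empty family is free; the same holds for \<open>l\<close>. For \<open>n = 1\<close> and
  \<open>k, l \<ge> 2\<close> both subspaces together would be a free family of size 2. The
  hypotheses exclude these degenerate cases.\<close>

theorem theorem7:
  fixes scale :: "'a::{field,finite} \<Rightarrow> 'v::ab_group_add \<Rightarrow> 'v"
    and q n k l :: nat
  assumes "vector_space scale"
    and "q = CARD('a)"
    and "vector_space.dim scale (UNIV :: 'v set) = n"
    and "odd n"
    and "k \<ge> 1" and "l \<ge> 1"
    and "real k \<le> (1 - sqrt 2 / 2) * real q"
    and "real l \<le> (1 - sqrt 2 / 2) * real q"
    and "n = 1 \<Longrightarrow> k = 1 \<or> l = 1"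
  shows "real (La_star scale {V_poset k, Lambda_poset l})
           = gaussian_binomial q n ((n - 1) div 2)
       \<and> (\<forall>F \<in> free_subspace_families scale {V_poset k, Lambda_poset l}.
            card F = La_star scale {V_poset k, Lambda_poset l} \<longrightarrow>
              F = subspaces_of_dim scale ((n - 1) div 2) \<or>
              F = subspaces_of_dim scale ((n + 1) div 2))"
proof -
  interpret vector_space scale by fact
  obtain B where "independent B" and span_B: "UNIV \<subseteq> span B" and card_B: "card B = n"
    using basis_exists[of UNIV] assms(3) by metis
  interpret finite_vector_space scale B q
  proof unfold_locales
    \<comment> \<open>An infinite set has \<open>card\<close> 0, which is even, so the odd
      \<open>n\<close> makes the basis finite.\<close>
    show "finite B" using card_B \<open>odd n\<close> by (metis card.infinite even_zero)
  qed (use \<open>independent B\<close> span_B assms(2) in auto)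
  obtain m where n: "n = 2 * m + 1" using \<open>odd n\<close> by (auto elim: oddE)
  have dimension: "dimension = 2 * m + 1" using card_B n by (simp add: dimension_def)
  let ?Free = "free_subspace_families scale {V_poset k, Lambda_poset l}"
  have max: "card F \<le> card (subspaces_of_dim scale m) \<and>
      (card F = card (subspaces_of_dim scale m) \<longrightarrow>
        F = subspaces_of_dim scale m \<or> F = subspaces_of_dim scale (Suc m))" if "F \<in> ?Free" for F
    using assms(9) n
    by (intro maximum_sparse[OF dimension sparse_if_free[OF that assms(5,6)] assms(5,7,8)]) simp
  have "finite ?Free"
    by (rule finite_subset[of _ UNIV]) (use finite_space in \<open>simp_all add: Finite_Set.finite_set\<close>)
  \<comment> \<open>The maximum is attained at the level \<open>m\<close>, which is free by
    \<open>free_level\<close>.\<close>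
  hence La: "La_star scale {V_poset k, Lambda_poset l} = card (subspaces_of_dim scale m)"
    unfolding La_star_def using max free_level[OF assms(5,6), of m] by (intro Max_eqI) auto
  have "(n - 1) div 2 = m" "(n + 1) div 2 = Suc m" using n by simp_all
  thus ?thesis
    using max La card_subspaces_of_dim[of m] dimension n by simp
qed

end
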